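(* The $3\times 3$ rooks graph $R_3=K_3\square K_3$ is, up to isomorphism, the unique connected graph $G$ on $9$ vertices with $c_L(G)=3$; that is, $c_L(K_3\square K_3)=3$, and every connected graph $H$ on $9$ vertices that is not isomorphic to $K_3\square K_3$ satisfies $c_L(H)\leq 2$.
   Context: All graphs are finite, simple, undirected and connected. For graphs $G,H$, the Cartesian product $G\square H$ has vertex set $V(G)\times V(H)$, with $(u,v)$ adjacent to $(x,y)$ if and only if ($u=x$ and $v$ is adjacent to $y$ in $H$) or ($u$ is adjacent to $x$ in $G$ and $v=y$). Lazy cops and robbers with $k$ cops on a graph $G$: first each cop chooses a starting vertex; then, seeing this, the robber chooses a starting vertex. The two sides then alternate turns, with perfect information, the cops going first. On the cops' turn, at most one cop (chosen by the cops) may move along an edge of $G$ to an adjacent vertex, and all other cops stay put. On the robber's turn, he may move along an edge or stay put. The cops win if at any point a cop occupies the same vertex as the robber; the robber wins if he evades the cops indefinitely. The lazy cop number $c_L(G)$ is the minimum $k$ for which $k$ cops have a strategy guaranteeing that they catch the robber after finitely many moves. *)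

theory Defs
  imports
    "Graph_Theory.Pair_Digraph"
    "Graph_Theory.Digraph_Component"
    "Graph_Theory.Digraph_Isomorphism"
begin

text \<open>A finite simple undirected graph is a \<^locale>\<open>pair_graph\<close>: a finite vertex set with a
  symmetric, loop-free set of ordered pairs of vertices.  Each undirected edge is present as two
  arcs, so \<open>(u, v) \<in> parcs G\<close> says that \<open>u\<close> and \<open>v\<close> are adjacent.\<close>

definition connected_graph :: "'a pair_pre_digraph \<Rightarrow> bool" where
  "connected_graph G \<longleftrightarrow> pair_graph G \<and> connected (with_proj G)"

definition complete_graph :: "nat \<Rightarrow> nat pair_pre_digraph" where
  "complete_graph n = \<lparr> pverts = {..<n}, parcs = {(u, v). u < n \<and> v < n \<and> u \<noteq> v} \<rparr>"

definition cartesian_product ::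
    "'a pair_pre_digraph \<Rightarrow> 'b pair_pre_digraph \<Rightarrow> ('a \<times> 'b) pair_pre_digraph"
    (infixl \<open>\<box>\<close> 70) where
  "G \<box> H = \<lparr> pverts = pverts G \<times> pverts H,
     parcs = {((u, v), (x, y)). (u, v) \<in> pverts G \<times> pverts H \<and> (x, y) \<in> pverts G \<times> pverts H \<and>
       (u = x \<and> (v, y) \<in> parcs H \<or> (u, x) \<in> parcs G \<and> v = y)} \<rparr>"

definition graph_isomorphic :: "'a pair_pre_digraph \<Rightarrow> 'b pair_pre_digraph \<Rightarrow> bool" where
  "graph_isomorphic G H \<longleftrightarrow> digraph_iso (with_proj G) (with_proj H)"


text \<open>The positions of \<open>k\<close> cops form a list of length \<open>k\<close>, so several cops may share a vertex.\<close>

definition lazy_cop_move :: "'a pair_pre_digraph \<Rightarrow> 'a list \<Rightarrow> 'a list \<Rightarrow> bool" where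
  "lazy_cop_move G ps qs \<longleftrightarrow>
     qs = ps \<or> (\<exists>i < length ps. \<exists>v. (ps ! i, v) \<in> parcs G \<and> qs = ps[i := v])"

text \<open>The robber starts at \<open>r 0\<close>, and \<open>r (Suc n)\<close> is his position after his turn in round \<open>n\<close>.\<close>

definition robber_walk :: "'a pair_pre_digraph \<Rightarrow> (nat \<Rightarrow> 'a) \<Rightarrow> bool" where
  "robber_walk G r \<longleftrightarrow>
     r 0 \<in> pverts G \<and> (\<forall>n. r (Suc n) = r n \<or> (r n, r (Suc n)) \<in> parcs G)"

text \<open>A cop strategy maps the list of all robber positions seen so far to the new positions of the
  cops.  The history of the cops themselves is determined by this list and the strategy, so it is
  not a separate argument.  \<open>\<sigma> []\<close> is the initial placement, chosen before the robber appears;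
  \<open>\<sigma> [r 0, \<dots>, r n]\<close> is the placement after the cops' turn in round \<open>n\<close>, which precedes the
  robber's move from \<open>r n\<close> to \<open>r (Suc n)\<close>.\<close>

definition lazy_cop_strategy ::
    "'a pair_pre_digraph \<Rightarrow> nat \<Rightarrow> ('a list \<Rightarrow> 'a list) \<Rightarrow> bool" where
  "lazy_cop_strategy G k \<sigma> \<longleftrightarrow>
     length (\<sigma> []) = k \<and> set (\<sigma> []) \<subseteq> pverts G \<and>
     (\<forall>r. robber_walk G r \<longrightarrow>
       (\<forall>n. lazy_cop_move G (\<sigma> (map r [0..<n])) (\<sigma> (map r [0..<Suc n]))))"

text \<open>The two disjuncts are a capture by the robber's own placement or move (onto a cop) and a
  capture by the cops' turn.  Each \<open>r\<close> is continued past a capture, which is harmless: the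
  robber may always stay put, and so may the cops.\<close>

definition captures :: "('a list \<Rightarrow> 'a list) \<Rightarrow> (nat \<Rightarrow> 'a) \<Rightarrow> bool" where
  "captures \<sigma> r \<longleftrightarrow>
     (\<exists>n. r n \<in> set (\<sigma> (map r [0..<n])) \<or> r n \<in> set (\<sigma> (map r [0..<Suc n])))"

definition lazy_cops_win :: "'a pair_pre_digraph \<Rightarrow> nat \<Rightarrow> bool" where
  "lazy_cops_win G k \<longleftrightarrow>
     (\<exists>\<sigma>. lazy_cop_strategy G k \<sigma> \<and> (\<forall>r. robber_walk G r \<longrightarrow> captures \<sigma> r))"

definition lazy_cop_number :: "'a pair_pre_digraph \<Rightarrow> nat" where
  "lazy_cop_number G = (LEAST k. lazy_cops_win G k)"

text \<open>The minimum exists for every finite graph: a cop on each vertex wins at once.\<close>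

lemma lazy_cops_win_card:
  assumes "finite (pverts G)"
  shows "lazy_cops_win G (card (pverts G))"
proof -
  obtain ps where ps: "set ps = pverts G" "length ps = card (pverts G)"
    using assms by (metis finite_distinct_list distinct_card)
  have "lazy_cop_strategy G (card (pverts G)) (\<lambda>_. ps)"
    using ps by (simp add: lazy_cop_strategy_def lazy_cop_move_def)
  moreover have "captures (\<lambda>_. ps) r" if "robber_walk G r" for r
    using that ps by (auto simp: captures_def robber_walk_def)
  ultimately show ?thesis by (auto simp: lazy_cops_win_def)
qed

lemma lazy_cops_win_lazy_cop_number:
  assumes "finite (pverts G)"
  shows "lazy_cops_win G (lazy_cop_number G)"
  unfolding lazy_cop_number_def by (rule LeastI, rule lazy_cops_win_card[OF assms])

text \<open>On these graphs, \<^const>\<open>graph_isomorphic\<close> is the existence of an adjacency-preserving and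
  adjacency-reflecting bijection of the vertices.\<close>

lemma graph_isomorphic_iff:
  assumes "pair_graph G" "pair_graph H"
  shows "graph_isomorphic G H \<longleftrightarrow>
    (\<exists>f. bij_betw f (pverts G) (pverts H) \<and>
      (\<forall>u \<in> pverts G. \<forall>v \<in> pverts G. (u, v) \<in> parcs G \<longleftrightarrow> (f u, f v) \<in> parcs H))"
    (is "_ \<longleftrightarrow> (\<exists>f. ?iso f)")
proof
  interpret G: pair_graph G by fact
  assume "graph_isomorphic G H"
  then obtain h where h: "pre_digraph.digraph_isomorphism (with_proj G) h"
    and H: "with_proj H = app_iso h (with_proj G)"
    by (auto simp: graph_isomorphic_def digraph_iso_def)
  have V: "pverts H = iso_verts h ` pverts G" and A: "parcs H = iso_arcs h ` parcs G"
    and t: "iso_tail h = fst" "iso_head h = snd"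
    using H by (simp_all add: with_proj_def app_iso_def)
  have inj: "inj_on (iso_verts h) (pverts G)"
    and arc: "\<And>a. a \<in> parcs G \<Longrightarrow> iso_arcs h a = (iso_verts h (fst a), iso_verts h (snd a))"
    using h t by (auto simp: pre_digraph.digraph_isomorphism_def prod_eq_iff)
  have "?iso (iso_verts h)"
  proof (intro conjI ballI)
    show "bij_betw (iso_verts h) (pverts G) (pverts H)"
      using inj V by (simp add: bij_betw_def)
    fix u v assume uv: "u \<in> pverts G" "v \<in> pverts G"
    show "(u, v) \<in> parcs G \<longleftrightarrow> (iso_verts h u, iso_verts h v) \<in> parcs H"
    proof
      assume "(u, v) \<in> parcs G"
      then show "(iso_verts h u, iso_verts h v) \<in> parcs H"
        using arc A by (metis fst_conv snd_conv image_eqI)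
    next
      assume "(iso_verts h u, iso_verts h v) \<in> parcs H"
      then obtain x y where xy: "(x, y) \<in> parcs G" "iso_verts h u = iso_verts h x"
        "iso_verts h v = iso_verts h y" using arc A by auto
      moreover have "x \<in> pverts G" "y \<in> pverts G"
        using xy(1) by (auto dest: G.in_arcsD1 G.in_arcsD2)
      ultimately show "(u, v) \<in> parcs G" using inj uv by (metis inj_onD)
    qed
  qed
  then show "\<exists>f. ?iso f" by blast
next
  interpret G: pair_graph G by fact
  interpret H: pair_graph H by fact
  assume "\<exists>f. ?iso f"
  then obtain f where f: "?iso f" by blast
  define h where "h = \<lparr> iso_verts = f, iso_arcs = map_prod f f, iso_head = snd, iso_tail = fst \<rparr>"
  have inj: "inj_on f (pverts G)" and V: "pverts H = f ` pverts G"
    using f by (auto simp: bij_betw_def)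
  have A: "parcs H = map_prod f f ` parcs G"
  proof (intro equalityI subsetI)
    fix e assume e: "e \<in> parcs H"
    then obtain u v where "u \<in> pverts G" "v \<in> pverts G" "e = (f u, f v)"
      using V by (metis H.arc_fst_in_verts H.arc_snd_in_verts imageE prod.collapse)
    then show "e \<in> map_prod f f ` parcs G" using e f by force
  next
    fix e assume "e \<in> map_prod f f ` parcs G"
    then show "e \<in> parcs H" using f by (auto dest: G.in_arcsD1 G.in_arcsD2)
  qed
  have "inj_on (map_prod f f) (parcs G)"
    by (rule inj_on_subset[OF map_prod_inj_on[OF inj inj]]) (auto dest: G.in_arcsD1 G.in_arcsD2)
  then have "pre_digraph.digraph_isomorphism (with_proj G) h"
    using inj G.wf_digraph by (auto simp: pre_digraph.digraph_isomorphism_def h_def)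
  moreover have "with_proj H = app_iso h (with_proj G)"
    by (simp add: with_proj_def app_iso_def h_def V A)
  ultimately show "graph_isomorphic G H"
    by (auto simp: graph_isomorphic_def digraph_iso_def)
qed

end

theory Submission
  imports Defs
begin

text \<open>Two lazy cops lose on the \<open>3 \<times> 3\<close> rook's graph because they always leave a row and a
  column free: a robber on the crossing of a free row and a free column is adjacent to no cop, and
  since a single cop move keeps either the rows or the columns of the cops, the robber can slide along
  his still free line to the next such crossing.  Three cops on the diagonal dominate the board.

  For the converse let \<open>G\<close> be a connected graph on nine vertices on which two cops do not win.  Put
  one cop on a vertex \<open>v\<close> of maximum degree.  As long as this guard stays, the robber is confined to a
  component \<open>K\<close> of \<open>G - N[v]\<close>, and for some such \<open>K\<close> the second cop has no winning position against
  all places of the robber; call this \<open>K\<close> a refuge.  Three arguments restrict it.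
  If a vertex \<open>d\<close> of \<open>K\<close> dominates all of \<open>K\<close> but one vertex \<open>e\<close>, then \<open>e\<close> has two neighbors in \<open>K\<close>
  and two in \<open>N(v)\<close>, since a cop could advance onto an only neighbor of \<open>e\<close> there, and a robber
  without an exit to \<open>N(v)\<close> is pinned on \<open>e\<close> (lemma \<open>last_hideout\<close>).  A refuge that contains
  at most two neighbors of each of its vertices is a cycle, since a path can be swept from its end (lemma
  \<open>refuge_two_regular\<close>).  In a refuge that is a pentagon every vertex has
  a neighbor in \<open>N(v)\<close>, since the second cop can drive the robber around the pentagon to a place where
  the guard leaves \<open>v\<close> to cut him off (lemma \<open>pentagon_refuge_leaky\<close>).

  Since \<open>K\<close> has at most \<open>8 - deg v\<close> vertices, this leaves two cases.  If \<open>v\<close> has degree three, then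
  \<open>K\<close> is a pentagon consisting of all non-neighbors of \<open>v\<close>, and these all have degree three; then the
  graph is cubic on nine vertices, against the parity of the degree sum.  If \<open>v\<close> has degree four,
  then \<open>K\<close> is a quadrilateral, and each of its vertices is the last hideout when the second cop is on
  the opposite one.  The graph is then 4-regular, and the conditions on last hideouts determine all
  adjacencies: it is the rook's graph (lemma \<open>rook_like_coordinates\<close>).\<close>


section \<open>Winning positions of two lazy cops\<close>

text \<open>The board is given by a bare adjacency relation, with connectedness in the form in which the
  game uses it: positions that win spread along an edge that leaves the set of known ones.\<close>

locale finite_connected_graph =
  fixes V :: "'a set" and adj :: "'a \<Rightarrow> 'a \<Rightarrow> bool" (infix \<open>\<sim>\<close> 50)
  assumes finite_V: "finite V"
    and adj_sym: "x \<sim> y \<Longrightarrow> y \<sim> x"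
    and adj_irrefl: "\<not> x \<sim> x"
    and adj_in_V: "x \<sim> y \<Longrightarrow> x \<in> V \<and> y \<in> V"
    and crossing_edge: "B \<subseteq> V \<Longrightarrow> B \<noteq> {} \<Longrightarrow> B \<noteq> V \<Longrightarrow> \<exists>x\<in>B. \<exists>y\<in>V - B. x \<sim> y"
begin

definition nbrs :: "'a \<Rightarrow> 'a set" where
  "nbrs x = {y. x \<sim> y}"

definition closed_nbrs :: "'a \<Rightarrow> 'a set" where
  "closed_nbrs x = insert x (nbrs x)"

lemma in_nbrs [simp]: "y \<in> nbrs x \<longleftrightarrow> x \<sim> y"
  by (simp add: nbrs_def)

lemma in_closed_nbrs [simp]: "y \<in> closed_nbrs x \<longleftrightarrow> y = x \<or> x \<sim> y"
  by (simp add: closed_nbrs_def)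

lemma adj_commute: "x \<sim> y \<longleftrightarrow> y \<sim> x"
  using adj_sym by blast

lemma adj_neq: "x \<sim> y \<Longrightarrow> x \<noteq> y"
  using adj_irrefl by blast

lemma nbrs_subset_V: "nbrs x \<subseteq> V"
  using adj_in_V by auto

lemma finite_nbrs [simp]: "finite (nbrs x)"
  using nbrs_subset_V finite_V finite_subset by blast

lemma finite_closed_nbrs [simp]: "finite (closed_nbrs x)"
  by (simp add: closed_nbrs_def)

lemma card_closed_nbrs: "card (closed_nbrs x) = Suc (card (nbrs x))"
  by (simp add: closed_nbrs_def adj_irrefl)

text \<open>The cops stand on the first two vertices, the robber on the third, and the cops are to move.\<close>

inductive wins :: "'a \<Rightarrow> 'a \<Rightarrow> 'a \<Rightarrow> bool" where
  capture: "r \<in> closed_nbrs c \<union> closed_nbrs d \<Longrightarrow> wins c d r"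
| move_first: "c' \<in> closed_nbrs c \<Longrightarrow> (\<And>r'. r' \<in> closed_nbrs r \<Longrightarrow> wins c' d r') \<Longrightarrow> wins c d r"
| move_second: "d' \<in> closed_nbrs d \<Longrightarrow> (\<And>r'. r' \<in> closed_nbrs r \<Longrightarrow> wins c d' r') \<Longrightarrow> wins c d r"

definition cop_step :: "'a \<times> 'a \<Rightarrow> 'a \<times> 'a \<Rightarrow> bool" where
  "cop_step p q \<longleftrightarrow>
     fst q \<in> closed_nbrs (fst p) \<and> snd q = snd p \<or> fst q = fst p \<and> snd q \<in> closed_nbrs (snd p)"

text \<open>A bound on the number of rounds is what the cops decrease when they play.  The graph is finite,
  so the bounds for the replies of the robber have a maximum.\<close>

primrec wins_within :: "nat \<Rightarrow> 'a \<times> 'a \<Rightarrow> 'a \<Rightarrow> bool" where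
  "wins_within 0 p r \<longleftrightarrow> r \<in> closed_nbrs (fst p) \<union> closed_nbrs (snd p)"
| "wins_within (Suc n) p r \<longleftrightarrow> wins_within n p r \<or>
     (\<exists>q. cop_step p q \<and> (\<forall>r'\<in>closed_nbrs r. wins_within n q r'))"

lemma wins_within_mono: "wins_within m p r \<Longrightarrow> m \<le> n \<Longrightarrow> wins_within n p r"
  by (induction n) (auto simp: le_Suc_eq)

lemma uniform_wins_within:
  assumes "finite S" "\<And>r'. r' \<in> S \<Longrightarrow> \<exists>n. wins_within n q r'"
  shows "\<exists>n. \<forall>r'\<in>S. wins_within n q r'"
  using assms
proof (induction S rule: finite_induct)
  case (insert x S)
  then obtain m n where "wins_within m q x" "\<forall>r'\<in>S. wins_within n q r'"
    by (metis insert_iff)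
  then have "\<forall>r'\<in>insert x S. wins_within (max m n) q r'"
    by (auto intro: wins_within_mono)
  then show ?case ..
qed simp

lemma wins_imp_wins_within: "wins c d r \<Longrightarrow> \<exists>n. wins_within n (c, d) r"
proof (induction rule: wins.induct)
  case (capture r c d)
  then have "wins_within 0 (c, d) r" by simp
  then show ?case ..
next
  case (move_first c' c r d)
  then obtain n where "\<forall>r'\<in>closed_nbrs r. wins_within n (c', d) r'"
    using uniform_wins_within[of "closed_nbrs r"] finite_closed_nbrs by blast
  moreover have "cop_step (c, d) (c', d)"
    using move_first.hyps by (simp add: cop_step_def)
  ultimately have "wins_within (Suc n) (c, d) r"
    unfolding wins_within.simps by blast
  then show ?case ..
next
  case (move_second d' d r c)
  then obtain n where "\<forall>r'\<in>closed_nbrs r. wins_within n (c, d') r'"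
    using uniform_wins_within[of "closed_nbrs r"] finite_closed_nbrs by blast
  moreover have "cop_step (c, d) (c, d')"
    using move_second.hyps by (simp add: cop_step_def)
  ultimately have "wins_within (Suc n) (c, d) r"
    unfolding wins_within.simps by blast
  then show ?case ..
qed

text \<open>One move that works for every bound at once: it is taken from the least bound \<open>n\<close> for which
  the position is won.  Where no bound exists the cops just stay.\<close>

lemma good_reply:
  "\<exists>q. cop_step p q \<and> (\<forall>n. wins_within n p r \<longrightarrow> r = fst q \<or> r = snd q \<or>
     (\<exists>m<n. \<forall>r'\<in>closed_nbrs r. wins_within m q r'))"
proof (cases "\<exists>n. wins_within n p r")
  case False
  then show ?thesis by (intro exI[of _ p]) (simp add: cop_step_def)
next
  case True
  define n where "n = (LEAST n. wins_within n p r)"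
  have n: "wins_within n p r" and least: "\<And>k. wins_within k p r \<Longrightarrow> n \<le> k"
    unfolding n_def using True by (auto intro: LeastI_ex Least_le)
  show ?thesis
  proof (cases n)
    case 0
    then have "cop_step p (r, snd p) \<or> cop_step p (fst p, r)"
      using n by (auto simp: cop_step_def)
    then show ?thesis by (metis fst_conv snd_conv)
  next
    case (Suc m)
    then have "\<not> wins_within m p r" using least[of m] by auto
    then obtain q where "cop_step p q" "\<forall>r'\<in>closed_nbrs r. wins_within m q r'"
      using n Suc by auto
    moreover have "m < k" if "wins_within k p r" for k
      using least[OF that] Suc by simp
    ultimately show ?thesis by blast
  qed
qed

end

section \<open>From winning positions to strategies\<close>

locale connected_pair_graph =
  fixes G :: "'a pair_pre_digraph"
  assumes connected_graph: "connected_graph G"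
begin

sublocale pair_graph G
  using connected_graph by (simp add: connected_graph_def)

sublocale finite_connected_graph "pverts G" "\<lambda>x y. (x, y) \<in> parcs G"
proof
  show "finite (pverts G)" by simp
  show "(y, x) \<in> parcs G" if "(x, y) \<in> parcs G" for x y
    using that by (simp add: arcs_symmetric)
  show "(x, x) \<notin> parcs G" for x
    using no_loops' by auto
  show "x \<in> pverts G \<and> y \<in> pverts G" if "(x, y) \<in> parcs G" for x y
    using that by (auto dest: in_arcsD1 in_arcsD2)
  show "\<exists>x\<in>B. \<exists>y\<in>pverts G - B. (x, y) \<in> parcs G"
    if B: "B \<subseteq> pverts G" "B \<noteq> {}" "B \<noteq> pverts G" for B
  proof (rule ccontr)
    assume no: "\<not> ?thesis"
    obtain u w where uw: "u \<in> B" "w \<in> pverts G" "w \<notin> B" using B by blast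
    have con: "connected (with_proj G)"
      using connected_graph by (simp add: connected_graph_def)
    have "u \<rightarrow>\<^sup>*\<^bsub>with_proj G\<^esub> w"
    proof -
      have "strongly_connected (with_proj G)"
        using con symmetric_connected_imp_strongly_connected sym_arcs by blast
      then show ?thesis using uw B by (auto simp: strongly_connected_def)
    qed
    then have "w \<in> B"
    proof (induction rule: reachable_induct)
      case base then show ?case using uw by simp
    next
      case (step x y)
      then show ?case using no by (auto simp: dominatesI dest: in_arcsD2)
    qed
    with uw show False by simp
  qed
qed

text \<open>The strategy is positional: the cops replay the robber's history through the replies of
  \<open>good_reply\<close>, and the bound drops in each round until the robber is caught.\<close>

lemma lazy_cops_win_2:
  assumes c: "c \<in> pverts G" "d \<in> pverts G"
    and win: "\<And>r. r \<in> pverts G \<Longrightarrow> wins c d r"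
  shows "lazy_cops_win G 2"
proof -
  have "\<forall>p r. \<exists>q. cop_step p q \<and> (\<forall>n. wins_within n p r \<longrightarrow> r = fst q \<or> r = snd q \<or>
     (\<exists>m<n. \<forall>r'\<in>closed_nbrs r. wins_within m q r'))"
    using good_reply by blast
  then obtain f where step: "\<And>p r. cop_step p (f p r)"
    and f: "\<And>p r n. wins_within n p r \<Longrightarrow> r = fst (f p r) \<or> r = snd (f p r) \<or>
     (\<exists>m<n. \<forall>r'\<in>closed_nbrs r. wins_within m (f p r) r')"
    by metis
  define S where "S = foldl f (c, d)"
  define \<sigma> where "\<sigma> h = [fst (S h), snd (S h)]" for h
  have S_snoc: "S (map r [0..<Suc n]) = f (S (map r [0..<n])) (r n)" for r n
    by (simp add: S_def)
  have "lazy_cop_move G [fst p, snd p] [fst q, snd q]" if "cop_step p q" for p q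
  proof -
    have "lazy_cop_move G [fst p, snd p] [x, snd p]" if "x \<in> closed_nbrs (fst p)" for x
      using that by (auto simp: lazy_cop_move_def intro!: exI[of _ 0])
    moreover have "lazy_cop_move G [fst p, snd p] [fst p, x]" if "x \<in> closed_nbrs (snd p)" for x
      using that by (auto simp: lazy_cop_move_def intro!: exI[of _ "1::nat"])
    ultimately show ?thesis using that by (auto simp: cop_step_def)
  qed
  then have "lazy_cop_strategy G 2 \<sigma>"
    unfolding lazy_cop_strategy_def \<sigma>_def S_snoc using c step by (auto simp: S_def)
  moreover have "captures \<sigma> r" if walk: "robber_walk G r" for r
  proof -
    have "wins_within n (S (map r [0..<k])) (r k) \<Longrightarrow> captures \<sigma> r" for n k
    proof (induction n arbitrary: k rule: less_induct)
      case (less n)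
      let ?q = "f (S (map r [0..<k])) (r k)"
      consider "r k = fst ?q \<or> r k = snd ?q"
        | m where "m < n" "\<forall>r'\<in>closed_nbrs (r k). wins_within m ?q r'"
        using f[OF less.prems] by blast
      then show ?case
      proof cases
        case 1
        then have "r k \<in> set (\<sigma> (map r [0..<Suc k]))"
          unfolding \<sigma>_def S_snoc by auto
        then show ?thesis unfolding captures_def by blast
      next
        case 2
        have "r (Suc k) \<in> closed_nbrs (r k)"
          using walk by (auto simp: robber_walk_def)
        then have "wins_within m (S (map r [0..<Suc k])) (r (Suc k))"
          unfolding S_snoc using 2 by blast
        then show ?thesis by (rule less.IH[OF \<open>m < n\<close>])
      qed
    qed
    moreover have "\<exists>n. wins_within n (S (map r [0..<0])) (r 0)"
      using win[of "r 0"] walk wins_imp_wins_within by (simp add: S_def robber_walk_def)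
    ultimately show ?thesis by blast
  qed
  ultimately show ?thesis unfolding lazy_cops_win_def by blast
qed

end

section \<open>Refuges\<close>

context finite_connected_graph
begin

text \<open>The robber cannot leave \<open>e\<close> while the cop on \<open>d\<close> stays, so the other cop simply walks to \<open>e\<close>;
  formally, an edge out of the set of winning places for him would make one more place winning.\<close>

lemma pinned_robber_loses:
  assumes "c \<in> V" "e \<in> V" and pinned: "nbrs e \<subseteq> closed_nbrs d"
  shows "wins c d e"
proof (rule ccontr)
  define B where "B = {c \<in> V. wins c d e}"
  assume "\<not> wins c d e"
  then have "B \<subseteq> V" "B \<noteq> V" using \<open>c \<in> V\<close> by (auto simp: B_def)
  moreover have "e \<in> B" using \<open>e \<in> V\<close> by (auto simp: B_def intro: wins.capture)
  ultimately obtain x y where xy: "x \<in> B" "y \<in> V - B" "x \<sim> y"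
    using crossing_edge[of B] by blast
  have "wins y d e"
  proof (rule wins.move_first[of x])
    show "x \<in> closed_nbrs y" using xy by (simp add: adj_commute)
    show "wins x d r" if "r \<in> closed_nbrs e" for r
    proof (cases "r = e")
      case True then show ?thesis using xy by (simp add: B_def)
    next
      case False then show ?thesis using that pinned by (intro wins.capture) auto
    qed
  qed
  then show False using xy by (auto simp: B_def)
qed

text \<open>A component of the graph without the closed neighborhood of \<open>v\<close>.  Connectedness is again
  phrased by cuts, which pass to subsets more easily than paths.\<close>

definition territory :: "'a \<Rightarrow> 'a set \<Rightarrow> bool" where
  "territory v K \<longleftrightarrow> K \<subseteq> V - closed_nbrs v \<and> K \<noteq> {} \<and> (\<forall>x\<in>K. nbrs x \<subseteq> K \<union> nbrs v) \<and>
     (\<forall>B\<subseteq>K. B \<noteq> {} \<longrightarrow> B \<noteq> K \<longrightarrow> (\<exists>x\<in>B. \<exists>y\<in>K - B. x \<sim> y))"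

lemma territory_exists:
  assumes "r \<in> V - closed_nbrs v"
  shows "\<exists>K. territory v K \<and> r \<in> K"
proof -
  \<comment> \<open>The component of \<open>r\<close> is the smallest set that contains \<open>r\<close> and can be left only through \<open>N(v)\<close>.\<close>
  define P where "P K \<longleftrightarrow> K \<subseteq> V - closed_nbrs v \<and> r \<in> K \<and> (\<forall>x\<in>K. nbrs x \<subseteq> K \<union> nbrs v)" for K
  have "nbrs x \<subseteq> (V - closed_nbrs v) \<union> nbrs v" if "x \<in> V - closed_nbrs v" for x
    using that nbrs_subset_V[of x] by (auto simp: adj_commute)
  then have "P (V - closed_nbrs v)"
    using assms by (auto simp: P_def)
  then obtain K where PK: "P K" and min: "\<And>L. P L \<Longrightarrow> card K \<le> card L"
    using ex_has_least_nat[of P _ card] by blast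
  note K = PK[unfolded P_def]
  have fin: "finite K" using K finite_V by (meson finite_Diff finite_subset)
  have "\<exists>x\<in>B. \<exists>y\<in>K - B. x \<sim> y" if B: "B \<subseteq> K" "B \<noteq> {}" "B \<noteq> K" for B
  proof (rule ccontr)
    assume no: "\<not> ?thesis"
    have less: "card B < card K" "card (K - B) < card K"
      using B psubset_card_mono[OF fin, of B] psubset_card_mono[OF fin, of "K - B"] by blast+
    show False
    proof (cases "r \<in> B")
      case True
      have "nbrs x \<subseteq> B \<union> nbrs v" if "x \<in> B" for x
      proof
        fix y assume "y \<in> nbrs x"
        then have "x \<sim> y" "y \<in> K \<union> nbrs v" using K that B by (simp, blast)
        then show "y \<in> B \<union> nbrs v" using no that by blast
      qed
      then have "P B" unfolding P_def using K B True by blast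
      from min[OF this] less show False by simp
    next
      case False
      have "nbrs x \<subseteq> (K - B) \<union> nbrs v" if "x \<in> K - B" for x
      proof
        fix y assume "y \<in> nbrs x"
        then have "y \<sim> x" "y \<in> K \<union> nbrs v" using K that by (simp add: adj_commute, blast)
        then show "y \<in> (K - B) \<union> nbrs v" using no that by blast
      qed
      then have "P (K - B)" unfolding P_def using K False by blast
      from min[OF this] less show False by simp
    qed
  qed
  then have "territory v K" using K unfolding territory_def by auto
  then show ?thesis using K by blast
qed

lemma territory_touches_guard:
  assumes "territory v K" "v \<in> V"
  shows "\<exists>x\<in>K. nbrs x \<inter> nbrs v \<noteq> {}"
proof -
  have "K \<subseteq> V" "K \<noteq> {}" "v \<notin> K"
    using assms(1) in_closed_nbrs[of v v] unfolding territory_def by blast+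
  then have "K \<subseteq> V" "K \<noteq> {}" "K \<noteq> V" using assms(2) by blast+
  then obtain x y where xy: "x \<in> K" "y \<in> V - K" "x \<sim> y" using crossing_edge[of K] by blast
  moreover have "nbrs x \<subseteq> K \<union> nbrs v" using assms(1) xy unfolding territory_def by blast
  moreover have "y \<in> nbrs x" using xy by simp
  ultimately show ?thesis by blast
qed

text \<open>While a cop guards \<open>v\<close>, the other cop has no position from which the robber loses wherever
  in \<open>K\<close> he is.\<close>

definition refuge :: "'a \<Rightarrow> 'a set \<Rightarrow> bool" where
  "refuge v K \<longleftrightarrow> v \<in> V \<and> territory v K \<and> (\<forall>d\<in>V. \<exists>r\<in>K. \<not> wins v d r)"

text \<open>If some \<open>d0\<close> won against every place in the component of \<open>r\<close>, then so would the start \<open>d\<close>: the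
  second cop walks from \<open>d\<close> to \<open>d0\<close>, and meanwhile the robber cannot leave the component.\<close>

lemma refuge_exists:
  assumes "v \<in> V" "d \<in> V" "r \<in> V" "\<not> wins v d r"
  shows "\<exists>K. refuge v K"
proof -
  have "r \<in> V - closed_nbrs v" using assms by (auto intro: wins.capture)
  then obtain K where K: "territory v K" "r \<in> K" using territory_exists by blast
  have "\<exists>r\<in>K. \<not> wins v d0 r" if "d0 \<in> V" for d0
  proof (rule ccontr)
    define B where "B = {d \<in> V. \<forall>r\<in>K. wins v d r}"
    assume "\<not> (\<exists>r\<in>K. \<not> wins v d0 r)"
    then have "d0 \<in> B" using that by (simp add: B_def)
    moreover have "B \<noteq> V" using assms K(2) by (auto simp: B_def)
    ultimately obtain x y where xy: "x \<in> B" "y \<in> V - B" "x \<sim> y"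
      using crossing_edge[of B] B_def by blast
    have "wins v y s" if "s \<in> K" for s
    proof (rule wins.move_second[of x])
      show "x \<in> closed_nbrs y" using xy by (simp add: adj_commute)
      show "wins v x t" if t: "t \<in> closed_nbrs s" for t
      proof (cases "t \<in> K")
        case True then show ?thesis using xy by (simp add: B_def)
      next
        case False
        moreover have "t = s \<or> t \<in> nbrs s" using t by simp
        moreover have "nbrs s \<subseteq> K \<union> nbrs v" using \<open>s \<in> K\<close> K(1) unfolding territory_def by blast
        ultimately have "t \<in> nbrs v" using \<open>s \<in> K\<close> by blast
        then show ?thesis by (intro wins.capture) simp
      qed
    qed
    then show False using xy by (auto simp: B_def)
  qed
  then show ?thesis using K assms unfolding refuge_def by blast
qed

lemma refuge_territory: "refuge v K \<Longrightarrow> territory v K"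
  by (simp add: refuge_def)

lemma refuge_subset: "refuge v K \<Longrightarrow> K \<subseteq> V - closed_nbrs v"
  by (simp add: refuge_def territory_def)

lemma refuge_finite: "refuge v K \<Longrightarrow> finite K"
  using refuge_subset finite_V by (meson finite_Diff finite_subset)

lemma refuge_nbrs: "refuge v K \<Longrightarrow> x \<in> K \<Longrightarrow> nbrs x \<subseteq> K \<union> nbrs v"
  by (simp add: refuge_def territory_def)

lemma refuge_cut:
  "refuge v K \<Longrightarrow> B \<subseteq> K \<Longrightarrow> B \<noteq> {} \<Longrightarrow> B \<noteq> K \<Longrightarrow> \<exists>x\<in>B. \<exists>y\<in>K - B. x \<sim> y"
  by (simp add: refuge_def territory_def)

lemma refuge_not_dominated:
  assumes "refuge v K" "d \<in> V"
  shows "\<not> K \<subseteq> closed_nbrs d"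
  using assms unfolding refuge_def by (meson UnI2 subsetD wins.capture)

lemma refuge_degree_split:
  assumes "refuge v K" "x \<in> K"
  shows "card (nbrs x) = card (nbrs x \<inter> K) + card (nbrs x \<inter> nbrs v)"
proof -
  have "nbrs x = (nbrs x \<inter> K) \<union> (nbrs x \<inter> nbrs v)"
    using refuge_nbrs[OF assms] by blast
  moreover have "(nbrs x \<inter> K) \<inter> (nbrs x \<inter> nbrs v) = {}"
    using refuge_subset[OF assms(1)] by auto
  ultimately show ?thesis
    by (metis card_Un_disjoint finite_Int finite_nbrs)
qed

text \<open>With cops on \<open>v\<close> and \<open>d\<close> the robber has to be on \<open>e\<close>, and so the position \<open>(v, d, e)\<close> is not won.
  If the guard could step to a neighbor \<open>x\<close> of \<open>e\<close> such that \<open>d\<close> and \<open>x\<close> watch all neighbors of \<open>e\<close>,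
  the robber would be caught in the next round; this applies in particular to an only neighbor of \<open>e\<close>
  in \<open>N(v)\<close>.  Without any neighbor there, the robber is pinned on \<open>e\<close>.  If \<open>e\<close> had only one neighbor
  \<open>p\<close> in \<open>K\<close>, the cop on \<open>d\<close> would step to \<open>p\<close>.\<close>

lemma last_hideout:
  assumes K: "refuge v K" and d: "d \<in> V" and e: "e \<in> K" and cover: "K \<subseteq> insert e (closed_nbrs d)"
  shows last_hideout_not_pinned: "x \<in> nbrs v \<Longrightarrow> x \<sim> e \<Longrightarrow> \<not> nbrs e \<subseteq> closed_nbrs d \<union> closed_nbrs x"
    and last_hideout_inside: "2 \<le> card (nbrs e \<inter> K)"
    and last_hideout_outside: "2 \<le> card (nbrs e \<inter> nbrs v)"
    and last_hideout_degree: "4 \<le> card (nbrs e)"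
proof -
  have v: "v \<in> V" and eV: "e \<in> V" using K e refuge_subset by (auto simp: refuge_def)
  obtain s where "s \<in> K" "\<not> wins v d s" using K d by (auto simp: refuge_def)
  then have no: "\<not> wins v d e"
    using cover wins.capture by (metis UnI2 insertE subsetD)
  then have ed: "e \<notin> closed_nbrs d" using wins.capture by blast
  show np: "\<not> nbrs e \<subseteq> closed_nbrs d \<union> closed_nbrs x" if "x \<in> nbrs v" "x \<sim> e" for x
  proof
    assume sub: "nbrs e \<subseteq> closed_nbrs d \<union> closed_nbrs x"
    have "wins v d e"
      by (rule wins.move_first[of x], use that in simp, rule wins.capture)
        (use that sub in auto)
    with no show False ..
  qed
  have inK: "nbrs e \<inter> K \<subseteq> closed_nbrs d" using cover adj_irrefl by auto
  show two: "2 \<le> card (nbrs e \<inter> K)"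
  proof (rule ccontr)
    assume "\<not> ?thesis"
    then have "card (nbrs e \<inter> K) \<le> 1" by simp
    moreover have "nbrs e \<inter> K \<noteq> {}"
    proof
      assume "nbrs e \<inter> K = {}"
      then have "K = {e}" using refuge_cut[OF K, of "{e}"] e by (metis DiffD1 IntI empty_iff empty_subsetI in_nbrs insert_subset singletonD)
      then show False using refuge_not_dominated[OF K eV] by simp
    qed
    ultimately obtain p where p: "nbrs e \<inter> K = {p}"
      by (metis One_nat_def card_0_eq card_1_singletonE finite_Int finite_nbrs le_Suc_eq le_zero_eq)
    have "wins v d e"
    proof (rule wins.move_second[of p])
      show "p \<in> closed_nbrs d" using p inK by blast
      fix r assume "r \<in> closed_nbrs e"
      then have "r = e \<or> r \<in> nbrs e" by simp
      then have "r = e \<or> r = p \<or> r \<in> nbrs v" using refuge_nbrs[OF K e] p by blast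
      moreover have "p \<in> nbrs e" using p by blast
      then have "p \<sim> e" by (simp add: adj_commute)
      ultimately show "wins v p r" by (intro wins.capture) auto
    qed
    with no show False ..
  qed
  show two': "2 \<le> card (nbrs e \<inter> nbrs v)"
  proof (rule ccontr)
    assume "\<not> ?thesis"
    then have "card (nbrs e \<inter> nbrs v) \<le> 1" by simp
    moreover have "nbrs e \<inter> nbrs v \<noteq> {}"
    proof
      assume "nbrs e \<inter> nbrs v = {}"
      then have "nbrs e \<subseteq> closed_nbrs d" using refuge_nbrs[OF K e] inK by blast
      then show False using no pinned_robber_loses[OF v eV] by blast
    qed
    ultimately obtain x where x: "nbrs e \<inter> nbrs v = {x}"
      by (metis One_nat_def card_0_eq card_1_singletonE finite_Int finite_nbrs le_Suc_eq le_zero_eq)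
    have "nbrs e = nbrs e \<inter> K \<union> nbrs e \<inter> nbrs v" using refuge_nbrs[OF K e] by blast
    also have "\<dots> \<subseteq> closed_nbrs d \<union> closed_nbrs x"
      unfolding x using inK by (intro Un_mono) auto
    finally have "nbrs e \<subseteq> closed_nbrs d \<union> closed_nbrs x" .
    moreover have "x \<in> nbrs e" "x \<in> nbrs v" using x by blast+
    then have "x \<in> nbrs v" "x \<sim> e" by (simp_all add: adj_commute)
    ultimately show False using np by blast
  qed
  show "4 \<le> card (nbrs e)" using refuge_degree_split[OF K e] two two' by simp
qed

text \<open>The cop on \<open>p\<close> sweeps the path \<open>A\<close> that starts next to \<open>p\<close>.  The last assumption says that
  \<open>insert p A\<close> is connected; stated for all subsets of \<open>A\<close>, it survives the removal of the
  next vertex, because \<open>p\<close> has no other neighbor in \<open>A\<close>.\<close>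

lemma chase_along_path:
  assumes "finite A" "p \<notin> A" "r \<in> A"
    and "\<And>x. x \<in> A \<Longrightarrow> nbrs x \<subseteq> insert p A \<union> nbrs v"
    and "card (nbrs p \<inter> A) \<le> 1"
    and "\<And>x. x \<in> A \<Longrightarrow> card (nbrs x \<inter> insert p A) \<le> 2"
    and "\<And>B. B \<subseteq> A \<Longrightarrow> B \<noteq> {} \<Longrightarrow> \<exists>x\<in>B. \<exists>y\<in>insert p A - B. x \<sim> y"
  shows "wins v p r"
  using assms
proof (induction "card A" arbitrary: A p r rule: less_induct)
  case less
  obtain q where q: "q \<in> A" "q \<sim> p"
    using less.prems(7)[of A] less.prems(3) by auto
  have q_only: "x = q" if "x \<in> A" "p \<sim> x" for x
  proof -
    have "{q, x} \<subseteq> nbrs p \<inter> A" using that q by (auto simp: adj_commute)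
    then have "card {q, x} \<le> 1" using less.prems(5) card_mono[of "nbrs p \<inter> A" "{q, x}"] by simp
    then show "x = q" by (cases "x = q") auto
  qed
  \<comment> \<open>After the cop has stepped to \<open>q\<close>, the robber is confined to the rest of the path.\<close>
  define A' where "A' = A - {q}"
  have A: "A = insert q A'" and q': "q \<notin> A'" using q by (auto simp: A'_def)
  have smaller: "card A' < card A" unfolding A'_def using less.prems(1) q by (meson card_Diff1_less)
  show ?case
  proof (rule wins.move_second[of q])
    show "q \<in> closed_nbrs p" using q by (simp add: adj_commute)
    fix s assume s: "s \<in> closed_nbrs r"
    then have "s = r \<or> s \<in> nbrs r" by simp
    then have "s \<in> insert p A \<union> nbrs v" using less.prems(3) less.prems(4)[OF less.prems(3)] by blast
    then consider "s \<in> closed_nbrs v \<union> closed_nbrs q" | "s \<in> A'"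
      using q A by auto
    then show "wins v q s"
    proof cases
      case 1 then show ?thesis by (rule wins.capture)
    next
      case 2
      show ?thesis
      proof (rule less.hyps[OF smaller _ q' 2])
        show "finite A'" using less.prems(1) by (simp add: A'_def)
        show "nbrs x \<subseteq> insert q A' \<union> nbrs v" if "x \<in> A'" for x
        proof -
          have "p \<notin> nbrs x" using q_only[of x] that q' A by (auto simp: adj_commute)
          then show ?thesis using less.prems(4)[of x] that A by blast
        qed
        have "insert p (nbrs q \<inter> A') \<subseteq> nbrs q \<inter> insert p A" using q A by auto
        then have "card (insert p (nbrs q \<inter> A')) \<le> card (nbrs q \<inter> insert p A)"
          by (intro card_mono) auto
        also have "\<dots> \<le> 2" using less.prems(6) q by blast
        finally show "card (nbrs q \<inter> A') \<le> 1" using less.prems(2) by (simp add: A'_def)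
        show "card (nbrs x \<inter> insert q A') \<le> 2" if "x \<in> A'" for x
        proof -
          have "card (nbrs x \<inter> insert q A') \<le> card (nbrs x \<inter> insert p A)"
            using A by (intro card_mono) auto
          also have "\<dots> \<le> 2" using less.prems(6) that A by blast
          finally show ?thesis .
        qed
        show "\<exists>x\<in>B. \<exists>y\<in>insert q A' - B. x \<sim> y" if B: "B \<subseteq> A'" "B \<noteq> {}" for B
        proof -
          obtain x y where "x \<in> B" "y \<in> insert p A - B" "x \<sim> y"
            using less.prems(7)[of B] B A by blast
          moreover from this have "y \<noteq> p" using q_only[of x] B q' A by (auto simp: adj_commute)
          ultimately show ?thesis using A by blast
        qed
      qed
    qed
  qed
qed

lemma refuge_two_regular:
  assumes K: "refuge v K" and deg: "\<And>x. x \<in> K \<Longrightarrow> card (nbrs x \<inter> K) \<le> 2" and e: "e \<in> K"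
  shows "card (nbrs e \<inter> K) = 2"
proof (rule ccontr)
  assume "card (nbrs e \<inter> K) \<noteq> 2"
  then have one: "card (nbrs e \<inter> K) \<le> 1" using deg[OF e] by simp
  have ins: "insert e (K - {e}) = K" using e by auto
  have "wins v e r" if r: "r \<in> K" for r
  proof (cases "r = e")
    case True then show ?thesis by (intro wins.capture) simp
  next
    case False
    show ?thesis
    proof (rule chase_along_path[where A = "K - {e}"])
      show "finite (K - {e})" using refuge_finite[OF K] by simp
      show "card (nbrs e \<inter> (K - {e})) \<le> 1"
        using one card_mono[of "nbrs e \<inter> K" "nbrs e \<inter> (K - {e})"] by fastforce
      show "\<exists>x\<in>B. \<exists>y\<in>insert e (K - {e}) - B. x \<sim> y"
        if "B \<subseteq> K - {e}" "B \<noteq> {}" for B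
        unfolding ins using that e by (intro refuge_cut[OF K]) auto
    qed (use r False ins deg refuge_nbrs[OF K] in auto)
  qed
  then show False using K e refuge_subset[OF K] unfolding refuge_def by blast
qed

section \<open>Pentagonal refuges\<close>

text \<open>A 5-cycle to which a guard on \<open>v\<close> confines the robber.\<close>

definition pentagon :: "'a \<Rightarrow> 'a \<Rightarrow> 'a \<Rightarrow> 'a \<Rightarrow> 'a \<Rightarrow> 'a \<Rightarrow> bool" where
  "pentagon v a b c d e \<longleftrightarrow> a \<sim> b \<and> b \<sim> c \<and> c \<sim> d \<and> d \<sim> e \<and> e \<sim> a \<and>
     nbrs a \<subseteq> {e, b} \<union> nbrs v \<and> nbrs b \<subseteq> {a, c} \<union> nbrs v \<and> nbrs c \<subseteq> {b, d} \<union> nbrs v \<and>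
     nbrs d \<subseteq> {c, e} \<union> nbrs v \<and> nbrs e \<subseteq> {d, a} \<union> nbrs v"

lemma pentagon_rotate: "pentagon v a b c d e \<Longrightarrow> pentagon v b c d e a"
  by (auto simp: pentagon_def)

lemma pentagon_reverse: "pentagon v a b c d e \<Longrightarrow> pentagon v a e d c b"
  by (auto simp: pentagon_def adj_commute)

text \<open>Stepping towards a robber at distance two forces him one vertex further.\<close>

lemma pentagon_push:
  assumes "pentagon v a b c d e" "wins v b d"
  shows "wins v a c"
proof (rule wins.move_second[of b])
  show "b \<in> closed_nbrs a" using assms by (simp add: pentagon_def)
  fix r assume "r \<in> closed_nbrs c"
  then have "r = d \<or> r \<in> closed_nbrs v \<union> closed_nbrs b" using assms(1) by (auto simp: pentagon_def)
  then show "wins v b r" using assms(2) wins.capture by blast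
qed

text \<open>The cop on \<open>d\<close> watches one neighbor \<open>e\<close> of the robber.  The guard can afford to leave \<open>v\<close> for
  \<open>x\<close>, because \<open>a\<close> has no exit to \<open>N(v)\<close>; from \<open>x\<close> he watches the other neighbor \<open>b\<close>, and steps onto it
  in the next round.\<close>

lemma pentagon_trap:
  assumes pent: "pentagon v a b c d e" and a: "nbrs a \<inter> nbrs v = {}" and x: "x \<in> nbrs b \<inter> nbrs v"
  shows "wins v d a"
proof -
  have nbrs_a: "nbrs a \<subseteq> {e, b}" and adj: "a \<sim> b" "d \<sim> e" using pent a by (auto simp: pentagon_def)
  have "wins b d r" if "r \<in> closed_nbrs a" for r
    using that nbrs_a adj by (intro wins.capture) (auto simp: adj_commute)
  moreover have "b \<in> closed_nbrs x" using x by (simp add: adj_commute)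
  ultimately have "wins x d a" by (rule wins.move_first[rotated])
  moreover have "wins x d r" if "r \<in> nbrs a" for r
    using that nbrs_a adj x by (intro wins.capture) (auto simp: adj_commute)
  ultimately have "wins x d r" if "r \<in> closed_nbrs a" for r
    using that by (auto simp: closed_nbrs_def)
  moreover have "x \<in> closed_nbrs v" using x by simp
  ultimately show ?thesis by (rule wins.move_first[rotated])
qed

text \<open>The second cop is at distance two from the robber, in a fixed sense of rotation.  Pushing
  preserves this sense, so one trap wins all five of these positions.\<close>

definition pentagon_won :: "'a \<Rightarrow> 'a \<Rightarrow> 'a \<Rightarrow> 'a \<Rightarrow> 'a \<Rightarrow> 'a \<Rightarrow> bool" where
  "pentagon_won v a b c d e \<longleftrightarrow>
     wins v a c \<and> wins v b d \<and> wins v c e \<and> wins v d a \<and> wins v e b"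

lemma pentagon_chase:
  assumes pent: "pentagon v a b c d e" and a: "nbrs a \<inter> nbrs v = {}" and b: "nbrs b \<inter> nbrs v \<noteq> {}"
  shows "pentagon_won v a b c d e"
proof -
  note rot = pentagon_rotate
  have "wins v d a" using pentagon_trap[OF pent a] b by blast
  moreover from this have "wins v c e" by (rule pentagon_push[OF rot[OF rot[OF pent]]])
  moreover from this have "wins v b d" by (rule pentagon_push[OF rot[OF pent]])
  moreover from this have "wins v a c" by (rule pentagon_push[OF pent])
  moreover from this have "wins v e b" by (rule pentagon_push[OF rot[OF rot[OF rot[OF rot[OF pent]]]]])
  ultimately show ?thesis by (simp add: pentagon_won_def)
qed

text \<open>Somewhere along the rotation a vertex without an exit is followed by one with an exit.\<close>

lemma pentagon_won:
  assumes pent: "pentagon v a b c d e"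
    and closed: "x \<in> {a, b, c, d, e}" "nbrs x \<inter> nbrs v = {}"
    and leaky: "y \<in> {a, b, c, d, e}" "nbrs y \<inter> nbrs v \<noteq> {}"
  shows "pentagon_won v a b c d e"
proof -
  let ?D = "\<lambda>x. nbrs x \<inter> nbrs v \<noteq> {}"
  note pents = pent pentagon_rotate[OF pent] pentagon_rotate[OF pentagon_rotate[OF pent]]
    pentagon_rotate[OF pentagon_rotate[OF pentagon_rotate[OF pent]]]
    pentagon_rotate[OF pentagon_rotate[OF pentagon_rotate[OF pentagon_rotate[OF pent]]]]
  have "\<not> ?D a \<and> ?D b \<or> \<not> ?D b \<and> ?D c \<or> \<not> ?D c \<and> ?D d \<or> \<not> ?D d \<and> ?D e \<or> \<not> ?D e \<and> ?D a"
    using closed leaky by blast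
  then have "pentagon_won v a b c d e \<or> pentagon_won v b c d e a \<or> pentagon_won v c d e a b \<or>
      pentagon_won v d e a b c \<or> pentagon_won v e a b c d"
    using pents[THEN pentagon_chase] by blast
  then show ?thesis by (auto simp: pentagon_won_def)
qed

text \<open>The robber chooses the sense of rotation, but the reversed pentagon is a pentagon as well.\<close>

lemma pentagon_refuge_leaky:
  assumes K: "refuge v K" and pent: "pentagon v a b c d e" and KE: "K = {a, b, c, d, e}" and x: "x \<in> K"
  shows "nbrs x \<inter> nbrs v \<noteq> {}"
proof
  assume x0: "nbrs x \<inter> nbrs v = {}"
  obtain y where y: "y \<in> K" "nbrs y \<inter> nbrs v \<noteq> {}"
    using territory_touches_guard[of v K] K by (auto simp: refuge_def)
  have "pentagon_won v a b c d e" "pentagon_won v a e d c b"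
    using pentagon_won[OF pent, of x y] pentagon_won[OF pentagon_reverse[OF pent], of x y]
      x x0 y KE by auto
  then have "wins v a c" "wins v a d" by (auto simp: pentagon_won_def)
  moreover have "wins v a a" "wins v a b" "wins v a e"
    using pent by (auto simp: pentagon_def adj_commute intro!: wins.capture)
  moreover have "a \<in> V" using K KE refuge_subset by auto
  ultimately show False using K KE unfolding refuge_def by auto
qed


lemma other_neighbor:
  assumes "card (nbrs x \<inter> K) = 2" "x \<sim> y" "y \<in> K"
  obtains z where "z \<in> K" "x \<sim> z" "z \<noteq> y" "\<And>w. w \<in> K \<Longrightarrow> x \<sim> w \<Longrightarrow> w = y \<or> w = z"
proof -
  obtain s t where st: "nbrs x \<inter> K = {s, t}" "s \<noteq> t" using assms(1) by (auto simp: card_2_iff)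
  have mem: "w \<in> K \<and> x \<sim> w \<longleftrightarrow> w = s \<or> w = t" for w
    using st(1) in_nbrs by blast
  then have "y = s \<or> y = t" using assms by blast
  then show thesis
  proof
    assume "y = s" then show thesis using that[of t] mem st(2) by blast
  next
    assume "y = t" then show thesis using that[of s] mem st(2) by blast
  qed
qed

text \<open>Follow the cycle from \<open>t\<close> in both directions, to \<open>s\<close>, \<open>w\<close> on one side and to \<open>u\<close>, \<open>q\<close> on the
  other.  If the two walks met early, they would form a triangle or a quadrilateral without edges to the rest of \<open>K\<close>.\<close>

lemma refuge_is_pentagon:
  assumes K: "refuge v K" and five: "card K = 5" and deg: "\<And>x. x \<in> K \<Longrightarrow> card (nbrs x \<inter> K) = 2"
  obtains a b c d e where "pentagon v a b c d e" "K = {a, b, c, d, e}"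
proof -
  have not_closed: "\<exists>x\<in>B. \<exists>y\<in>K - B. x \<sim> y" if "B \<subseteq> K" "B \<noteq> {}" "card B < 5" for B
  proof -
    have "B \<noteq> K" using that(3) five by auto
    then show ?thesis by (rule refuge_cut[OF K that(1,2)])
  qed
  obtain t where t: "t \<in> K" using five by fastforce
  have "nbrs t \<inter> K \<noteq> {}" using deg[OF t] by auto
  then obtain s where s: "s \<in> K" "t \<sim> s" by auto
  obtain u where u: "u \<in> K" "t \<sim> u" "u \<noteq> s" and Nt: "\<And>w. w \<in> K \<Longrightarrow> t \<sim> w \<Longrightarrow> w = s \<or> w = u"
    using other_neighbor[OF deg[OF t] s(2,1)] by metis
  obtain w where w: "w \<in> K" "s \<sim> w" "w \<noteq> t" and Ns: "\<And>x. x \<in> K \<Longrightarrow> s \<sim> x \<Longrightarrow> x = t \<or> x = w"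
    using other_neighbor[OF deg[OF s(1)] adj_sym[OF s(2)] t] by metis
  obtain q where q: "q \<in> K" "u \<sim> q" "q \<noteq> t" and Nu: "\<And>x. x \<in> K \<Longrightarrow> u \<sim> x \<Longrightarrow> x = t \<or> x = q"
    using other_neighbor[OF deg[OF u(1)] adj_sym[OF u(2)] t] by metis
  obtain z where z: "z \<in> K" "w \<sim> z" "z \<noteq> s" and Nw: "\<And>x. x \<in> K \<Longrightarrow> w \<sim> x \<Longrightarrow> x = s \<or> x = z"
    using other_neighbor[OF deg[OF w(1)] adj_sym[OF w(2)] s(1)] by metis
  obtain y where y: "y \<in> K" "q \<sim> y" "y \<noteq> u" and Nq: "\<And>x. x \<in> K \<Longrightarrow> q \<sim> x \<Longrightarrow> x = u \<or> x = y"
    using other_neighbor[OF deg[OF q(1)] adj_sym[OF q(2)] u(1)] by metis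
  have "card {t, s, u} < 5" "card {t, s, u, w} < 5"
    by (simp_all add: card_insert_if)
  note small = this
  have wu: "w \<noteq> u"
  proof
    assume "w = u"
    then have "q = s" using Nu[OF s(1)] w(2) s(2) adj_sym adj_neq by metis
    then have "x' \<in> {t, s, u}" if "x \<in> {t, s, u}" "x' \<in> K" "x \<sim> x'" for x x'
      using that Nt[of x'] Ns[of x'] Nu[of x'] \<open>w = u\<close> by blast
    then show False using not_closed[of "{t, s, u}"] small t s u by blast
  qed
  have qs: "q \<noteq> s" using Ns[OF u(1)] wu q u adj_sym adj_irrefl by metis
  have qw: "q \<noteq> w"
  proof
    assume "q = w"
    then have "z = u" using Nw[OF u(1)] q(2) u(3) adj_sym by metis
    then have "x' \<in> {t, s, u, w}" if "x \<in> {t, s, u, w}" "x' \<in> K" "x \<sim> x'" for x x'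
      using that Nt[of x'] Ns[of x'] Nu[of x'] Nw[of x'] \<open>q = w\<close> by blast
    then show False using not_closed[of "{t, s, u, w}"] small t s u w by blast
  qed
  have "card {t, s, w, q, u} = 5"
    using s u w q wu qs qw adj_neq by (auto simp: card_insert_if)
  then have KE: "K = {t, s, w, q, u}"
    using card_subset_eq[OF refuge_finite[OF K], of "{t, s, w, q, u}"] t s u w q five by auto
  have "z \<noteq> t" using z Nt[OF w(1)] w wu adj_sym adj_neq by metis
  moreover have "z \<noteq> u" using z Nu[OF w(1)] w qw adj_sym by metis
  moreover have "z \<noteq> w" using z adj_neq by blast
  ultimately have zq: "z = q" using z KE by blast
  have yw: "y = w" using Nq[OF w(1)] z zq wu adj_sym by metis
  have sub: "nbrs x \<subseteq> {x1, x2} \<union> nbrs v" if "x \<in> K" "\<And>x'. x' \<in> K \<Longrightarrow> x \<sim> x' \<Longrightarrow> x' = x1 \<or> x' = x2"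
    for x x1 x2
    using refuge_nbrs[OF K that(1)] that(2) in_nbrs by blast
  have "nbrs t \<subseteq> {u, s} \<union> nbrs v" by (rule sub[OF t]) (use Nt in blast)
  moreover have "nbrs s \<subseteq> {t, w} \<union> nbrs v" by (rule sub[OF s(1)]) (use Ns in blast)
  moreover have "nbrs w \<subseteq> {s, q} \<union> nbrs v" by (rule sub[OF w(1)]) (use Nw zq in blast)
  moreover have "nbrs q \<subseteq> {w, u} \<union> nbrs v" by (rule sub[OF q(1)]) (use Nq yw in blast)
  moreover have "nbrs u \<subseteq> {q, t} \<union> nbrs v" by (rule sub[OF u(1)]) (use Nu in blast)
  ultimately have "pentagon v t s w q u"
    unfolding pentagon_def using s(2) w(2) z(2) zq adj_sym[OF q(2)] adj_sym[OF u(2)] by simp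
  then show thesis using KE that by blast
qed

section \<open>Guarding a vertex of maximum degree\<close>

text \<open>Let \<open>x\<close> have \<open>k\<close> neighbors in \<open>K\<close>.  As \<open>x\<close> does not dominate \<open>K\<close>, there are at least \<open>k + 2\<close>
  vertices in \<open>K\<close>, and in the case of equality the last one is a last hideout, so that the maximum
  degree is at least four.  With \<open>card K \<le> 8 - deg v\<close> this excludes \<open>k \<ge> 3\<close>; hence \<open>K\<close> is a cycle, and
  \<open>k = 2\<close>.  Some vertex of the cycle also has a neighbor in \<open>N(v)\<close>, so the maximum degree is at
  least three, and the same count leaves only the two cases.\<close>

lemma max_degree_refuge:
  assumes nine: "card V = 9" and K: "refuge v K" and max: "\<And>x. x \<in> V \<Longrightarrow> card (nbrs x) \<le> card (nbrs v)"
  shows max_degree_refuge_cases: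
      "card (nbrs v) = 3 \<and> card K = 5 \<or> card (nbrs v) = 4 \<and> card K = 4"
    and max_degree_refuge_two_regular: "x \<in> K \<Longrightarrow> card (nbrs x \<inter> K) = 2"
    and max_degree_refuge_eq: "K = V - closed_nbrs v"
proof -
  let ?D = "card (nbrs v)"
  have vV: "v \<in> V" using K by (simp add: refuge_def)
  have KV: "x \<in> V" if "x \<in> K" for x using refuge_subset[OF K] that by blast
  have "closed_nbrs v \<subseteq> V" using vV nbrs_subset_V by (simp add: closed_nbrs_def)
  then have cT: "card (V - closed_nbrs v) + ?D = 8"
    using card_Diff_subset[of "closed_nbrs v" V] card_mono[OF finite_V, of "closed_nbrs v"]
      card_closed_nbrs[of v] nine by simp
  have cK: "card K + ?D \<le> 8"
    using card_mono[OF _ refuge_subset[OF K]] finite_V cT by simp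
  have far: "card (K - closed_nbrs x) + Suc (card (nbrs x \<inter> K)) = card K" if x: "x \<in> K" for x
  proof -
    have "K \<inter> closed_nbrs x = insert x (nbrs x \<inter> K)" using x by auto
    then have "card (K \<inter> closed_nbrs x) = Suc (card (nbrs x \<inter> K))"
      by (simp add: adj_irrefl)
    moreover have "card K = card (K \<inter> closed_nbrs x) + card (K - closed_nbrs x)"
      using card_Int_Diff[OF refuge_finite[OF K]] .
    ultimately show ?thesis by simp
  qed
  have far_pos: "card (K - closed_nbrs x) \<noteq> 0" if x: "x \<in> K" for x
    using refuge_not_dominated[OF K KV[OF x]] refuge_finite[OF K] by simp
  \<comment> \<open>The one vertex far from \<open>x\<close> is a last hideout.\<close>
  have far_one: "4 \<le> ?D" if x: "x \<in> K" and one: "card (K - closed_nbrs x) = 1" for x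
  proof -
    obtain e where e: "K - closed_nbrs x = {e}" using one card_1_singletonE by blast
    then have "e \<in> K" "K \<subseteq> insert e (closed_nbrs x)" by blast+
    then show ?thesis using last_hideout_degree[OF K KV[OF x]] max[OF KV] le_trans by blast
  qed
  have le2: "card (nbrs x \<inter> K) \<le> 2" if x: "x \<in> K" for x
  proof (rule ccontr)
    assume "\<not> ?thesis"
    then have "3 \<le> card (nbrs x \<inter> K)" by simp
    moreover have "card (nbrs x \<inter> K) \<le> ?D"
      using card_mono[of "nbrs x" "nbrs x \<inter> K"] max[OF KV[OF x]] by simp
    ultimately show False using far[OF x] far_pos[OF x] far_one[OF x] cK by linarith
  qed
  show two: "card (nbrs x \<inter> K) = 2" if "x \<in> K" for x
    using refuge_two_regular[OF K le2 that] .
  obtain x where x: "x \<in> K" "nbrs x \<inter> nbrs v \<noteq> {}"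
    using territory_touches_guard[OF refuge_territory[OF K] vV] by blast
  then have "card (nbrs x \<inter> nbrs v) \<noteq> 0" by simp
  then have "3 \<le> ?D"
    using refuge_degree_split[OF K x(1)] two[OF x(1)] max[OF KV[OF x(1)]] by linarith
  then show cases: "?D = 3 \<and> card K = 5 \<or> ?D = 4 \<and> card K = 4"
    using far[OF x(1)] far_pos[OF x(1)] far_one[OF x(1)] two[OF x(1)] cK by linarith
  show "K = V - closed_nbrs v"
    using card_subset_eq[OF _ refuge_subset[OF K]] cases cT finite_V by auto
qed

text \<open>A neighbor \<open>y\<close> of \<open>v\<close> cannot be adjacent to \<open>v\<close> and to all of the \<open>k\<close> or more vertices far from
  \<open>v\<close>, so it is far from one of them, which has degree \<open>k\<close> and can take the place of \<open>v\<close>.\<close>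

lemma regular_if_far_vertices_regular:
  assumes v: "v \<in> V" "card (nbrs v) = k"
    and max: "\<And>x. x \<in> V \<Longrightarrow> card (nbrs x) \<le> k"
    and many: "k \<le> card (V - closed_nbrs v)"
    and far: "\<And>v x. v \<in> V \<Longrightarrow> card (nbrs v) = k \<Longrightarrow> x \<in> V - closed_nbrs v \<Longrightarrow> card (nbrs x) = k"
    and y: "y \<in> V"
  shows "card (nbrs y) = k"
proof (cases "y \<in> nbrs v")
  case False
  then show ?thesis using v far[OF v] y by (cases "y = v") auto
next
  case True
  have "\<not> insert v (V - closed_nbrs v) \<subseteq> nbrs y"
  proof
    assume "insert v (V - closed_nbrs v) \<subseteq> nbrs y"
    then have "card (insert v (V - closed_nbrs v)) \<le> card (nbrs y)" by (intro card_mono) auto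
    then show False using max[OF y] many finite_V by simp
  qed
  moreover have "v \<in> nbrs y" using True by (simp add: adj_commute)
  ultimately obtain t where t: "t \<in> V - closed_nbrs v" "t \<notin> nbrs y" by blast
  then have "t \<noteq> y" using True by auto
  then have "y \<in> V - closed_nbrs t" using t y by (auto simp: adj_commute)
  moreover have "card (nbrs t) = k" using far[OF v t(1)] .
  ultimately show ?thesis using far[of t y] t by blast
qed

text \<open>The handshake lemma; a numbering \<open>f\<close> of the vertices picks one of the two arcs of each edge.\<close>

lemma even_degree_sum: "even (\<Sum>x\<in>V. card (nbrs x))"
proof -
  obtain f :: "'a \<Rightarrow> nat" where f: "inj_on f V" using finite_imp_inj_to_nat_seg[OF finite_V] by blast
  let ?S = "SIGMA x:V. nbrs x"
  let ?L = "{e \<in> ?S. f (fst e) < f (snd e)}"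
  have fin: "finite ?S" using finite_V by simp
  have "?S = ?L \<union> prod.swap ` ?L"
  proof (intro equalityI subsetI)
    fix e assume e: "e \<in> ?S"
    obtain x y where xy: "e = (x, y)" "x \<sim> y" using e by auto
    have V: "x \<in> V" "y \<in> V" using adj_in_V[OF xy(2)] by auto
    then have "f x \<noteq> f y" using f adj_neq[OF xy(2)] by (meson inj_onD)
    then have "f x < f y \<or> f y < f x" by linarith
    then show "e \<in> ?L \<union> prod.swap ` ?L"
    proof
      assume "f y < f x"
      then have "(y, x) \<in> ?L" using V adj_sym[OF xy(2)] by simp
      then have "prod.swap (y, x) \<in> prod.swap ` ?L" by (rule imageI)
      then show ?thesis using xy by simp
    qed (use xy V in simp)
  next
    fix e assume "e \<in> ?L \<union> prod.swap ` ?L"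
    then obtain x y where "x \<sim> y" "e = (x, y) \<or> e = (y, x)" by auto
    then show "e \<in> ?S" using adj_in_V[of x y] adj_sym[of x y] by auto
  qed
  moreover have "?L \<inter> prod.swap ` ?L = {}" by auto
  moreover have "finite ?L" using finite_subset[OF _ fin, of ?L] by blast
  ultimately have "card ?S = card ?L + card (prod.swap ` ?L)"
    by (metis (no_types, lifting) card_Un_disjoint finite_imageI)
  also have "card (prod.swap ` ?L) = card ?L" by (simp add: card_image)
  finally have "even (card ?S)" by simp
  then show ?thesis using finite_V by simp
qed

text \<open>Every non-neighbor of a vertex of degree three lies on the pentagon and has an exit, hence has
  degree three.  So the graph would be cubic, with degree sum 27.\<close>

lemma degree_three_impossible:
  assumes nine: "card V = 9"
    and max: "\<And>x. x \<in> V \<Longrightarrow> card (nbrs x) \<le> 3"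
    and refuges: "\<And>v. v \<in> V \<Longrightarrow> \<exists>K. refuge v K"
    and v: "v \<in> V" "card (nbrs v) = 3"
  shows False
proof -
  have far: "card (nbrs x) = 3" if v: "v \<in> V" "card (nbrs v) = 3" and x: "x \<in> V - closed_nbrs v" for v x
  proof -
    obtain K where K: "refuge v K" using refuges v by blast
    note K_facts = max_degree_refuge_cases[OF nine K] max_degree_refuge_two_regular[OF nine K]
      max_degree_refuge_eq[OF nine K]
    have "card K = 5" and two: "\<And>x. x \<in> K \<Longrightarrow> card (nbrs x \<inter> K) = 2" and KE: "K = V - closed_nbrs v"
      using K_facts max v(2) by auto
    then obtain a b c d e where pent: "pentagon v a b c d e" "K = {a, b, c, d, e}"
      using refuge_is_pentagon[OF K] by metis
    have xK: "x \<in> K" using x KE by simp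
    have "card (nbrs x \<inter> nbrs v) \<noteq> 0"
      using pentagon_refuge_leaky[OF K pent xK] by simp
    then show ?thesis
      using refuge_degree_split[OF K xK] two[OF xK] max[of x] x by (simp del: card_0_eq)
  qed
  have "closed_nbrs v \<subseteq> V" using v nbrs_subset_V by (simp add: closed_nbrs_def)
  then have "card (V - closed_nbrs v) = 5"
    using card_Diff_subset[of "closed_nbrs v" V] card_closed_nbrs[of v] nine v by simp
  then have "card (nbrs y) = 3" if "y \<in> V" for y
    using regular_if_far_vertices_regular[OF v max _ far that] by simp
  then have "(\<Sum>x\<in>V. card (nbrs x)) = 27" using nine by simp
  then show False using even_degree_sum by (metis odd_numeral)
qed


end

section \<open>Recognizing the rook's graph\<close>

definition rook_move :: "nat \<times> nat \<Rightarrow> nat \<times> nat \<Rightarrow> bool" where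
  "rook_move p q \<longleftrightarrow> fst p = fst q \<and> snd p \<noteq> snd q \<or> fst p \<noteq> fst q \<and> snd p = snd q"

context finite_connected_graph
begin

text \<open>Two squares of the rook's board that share no line have exactly two common neighbors, which
  again share no line, and a square \<open>d\<close> that shares no line with either is not adjacent to these.\<close>

definition rook_pair :: "'a \<Rightarrow> 'a \<Rightarrow> bool" where
  "rook_pair v e \<longleftrightarrow> card (nbrs v \<inter> nbrs e) = 2 \<and>
     (\<forall>x\<in>nbrs v \<inter> nbrs e. \<forall>y\<in>nbrs v \<inter> nbrs e. \<not> x \<sim> y) \<and>
     (\<forall>x\<in>nbrs v \<inter> nbrs e. \<forall>d\<in>V - closed_nbrs v - closed_nbrs e. \<not> x \<sim> d)"

definition rook_like :: bool where
  "rook_like \<longleftrightarrow> (\<forall>v\<in>V. card (nbrs v) = 4) \<and> (\<forall>v\<in>V. \<forall>e\<in>V - closed_nbrs v. rook_pair v e)"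

text \<open>For \<open>v\<close> of degree four the refuge is a quadrilateral.  For a vertex \<open>e\<close> of it, the opposite
  vertex \<open>d\<close> is the only other vertex adjacent to neither \<open>v\<close> nor \<open>e\<close>, and \<open>e\<close> is the last hideout from \<open>d\<close>.
  If \<open>x\<close> and \<open>y\<close> are the two common neighbors of \<open>v\<close> and \<open>e\<close>, then a guard stepping to \<open>x\<close> would
  win if \<open>y\<close> were adjacent to \<open>x\<close> or to \<open>d\<close>.\<close>

lemma degree_four_rook_like:
  assumes nine: "card V = 9"
    and max: "\<And>x. x \<in> V \<Longrightarrow> card (nbrs x) \<le> 4"
    and refuges: "\<And>v. v \<in> V \<Longrightarrow> \<exists>K. refuge v K"
    and v: "v \<in> V" "card (nbrs v) = 4"
  shows rook_like
proof -
  have cT: "card (V - closed_nbrs v) = 4" if v: "v \<in> V" "card (nbrs v) = 4" for v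
  proof -
    have "closed_nbrs v \<subseteq> V" using v nbrs_subset_V by (simp add: closed_nbrs_def)
    then show ?thesis
      using card_Diff_subset[of "closed_nbrs v" V] card_closed_nbrs[of v] nine v by simp
  qed
  have far_vertex: "card (nbrs e) = 4 \<and> rook_pair v e"
    if v: "v \<in> V" "card (nbrs v) = 4" and e: "e \<in> V - closed_nbrs v" for v e
  proof -
    obtain K where K: "refuge v K" using refuges v by blast
    have max': "\<And>x. x \<in> V \<Longrightarrow> card (nbrs x) \<le> card (nbrs v)" using max v by simp
    have two: "card (nbrs x \<inter> K) = 2" if "x \<in> K" for x
      using max_degree_refuge_two_regular[OF nine K _ that] max' by blast
    have KE: "K = V - closed_nbrs v" using max_degree_refuge_eq[OF nine K] max' by blast
    have eK: "e \<in> K" using e KE by simp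
    have "K \<inter> closed_nbrs e = insert e (nbrs e \<inter> K)" using eK by auto
    then have "card (K \<inter> closed_nbrs e) = 3" using two[OF eK] by (simp add: adj_irrefl)
    then have "card (K - closed_nbrs e) = 1"
      using card_Int_Diff[OF refuge_finite[OF K], of "closed_nbrs e"] cT[OF v] KE by simp
    then obtain d where d: "K - closed_nbrs e = {d}" using card_1_singletonE by blast
    then have dK: "d \<in> K" and "\<not> d \<sim> e" "d \<noteq> e" by (auto simp: adj_commute)
    have dV: "d \<in> V" using dK KE by blast
    have "K \<inter> closed_nbrs d = insert d (nbrs d \<inter> K)" using dK by auto
    then have "card (K \<inter> closed_nbrs d) = 3" using two[OF dK] by (simp add: adj_irrefl)
    then have "card (K - closed_nbrs d) = 1"
      using card_Int_Diff[OF refuge_finite[OF K], of "closed_nbrs d"] cT[OF v] KE by simp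
    moreover have "e \<in> K - closed_nbrs d" using eK \<open>\<not> d \<sim> e\<close> \<open>d \<noteq> e\<close> by auto
    ultimately have "K - closed_nbrs d = {e}" by (metis card_1_singletonE singletonD)
    then have cover: "K \<subseteq> insert e (closed_nbrs d)" by blast
    have deg: "card (nbrs e) = 4"
      using last_hideout_degree[OF K dV eK cover] max[of e] e by (simp add: le_antisym)
    then have com: "card (nbrs e \<inter> nbrs v) = 2"
      using refuge_degree_split[OF K eK] two[OF eK] by simp
    have inside: "nbrs e \<inter> K \<subseteq> closed_nbrs d" using cover adj_irrefl by auto
    have key: "\<not> y \<in> closed_nbrs d \<union> closed_nbrs x"
      if xy: "x \<in> nbrs v" "e \<sim> x" "y \<in> nbrs v" "e \<sim> y" "x \<noteq> y" for x y
    proof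
      assume y: "y \<in> closed_nbrs d \<union> closed_nbrs x"
      have "{x, y} = nbrs e \<inter> nbrs v"
        using xy com by (intro card_subset_eq) auto
      then have "nbrs e \<subseteq> (nbrs e \<inter> K) \<union> {x, y}" using refuge_nbrs[OF K eK] by blast
      moreover have "x \<in> closed_nbrs x" by simp
      ultimately have "nbrs e \<subseteq> closed_nbrs d \<union> closed_nbrs x" using inside y by blast
      then show False using last_hideout_not_pinned[OF K dV eK cover xy(1)] xy(2) adj_sym by blast
    qed
    have indep: "\<not> x \<sim> y" if "x \<in> nbrs v \<inter> nbrs e" "y \<in> nbrs v \<inter> nbrs e" for x y
      using key[of x y] that adj_irrefl by auto
    have away: "\<not> y \<sim> d" if y: "y \<in> nbrs v \<inter> nbrs e" for y
    proof -
      have "nbrs e \<inter> nbrs v \<noteq> {y}" using com by auto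
      then obtain x where "x \<in> nbrs e \<inter> nbrs v" "x \<noteq> y" using y by blast
      then show ?thesis using key[of x y] y by (auto simp: adj_commute)
    qed
    have far: "V - closed_nbrs v - closed_nbrs e = {d}" using d KE by simp
    have com': "card (nbrs v \<inter> nbrs e) = 2" using com by (subst Int_commute)
    show ?thesis unfolding rook_pair_def far
    proof (intro conjI ballI)
      fix x d' assume x: "x \<in> nbrs v \<inter> nbrs e" and "d' \<in> {d}"
      then have "d' = d" by blast
      then show "\<not> x \<sim> d'" using away[OF x] by simp
    qed (fact deg com' indep)+
  qed
  have far_degree: "card (nbrs x) = 4"
    if "v \<in> V" "card (nbrs v) = 4" "x \<in> V - closed_nbrs v" for v x
    using far_vertex[OF that] by simp
  have regular: "card (nbrs y) = 4" if "y \<in> V" for y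
    using regular_if_far_vertices_regular[OF v max _ far_degree that] cT[OF v] by simp
  have "rook_pair v e" if "v \<in> V" "e \<in> V - closed_nbrs v" for v e
    using far_vertex[OF that(1) regular[OF that(1)] that(2)] by simp
  then show ?thesis unfolding rook_like_def using regular by blast
qed

lemma two_element_set:
  assumes "card A = 2" "x \<in> A"
  obtains y where "A = {x, y}" "x \<noteq> y"
proof -
  obtain s t where "A = {s, t}" "s \<noteq> t" using assms(1) by (auto simp: card_2_iff)
  then show thesis using that[of s] that[of t] assms(2) by blast
qed

text \<open>Let \<open>a, b, c, d\<close> be the quadrilateral of non-neighbors of \<open>v\<close>.  The four neighbors of \<open>v\<close> split
  into the pairs \<open>{p, q}\<close> adjacent to \<open>a\<close> and \<open>{r, s}\<close> adjacent to the opposite vertex \<open>c\<close>.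
  The vertex \<open>b\<close> sees one of each pair, say \<open>p\<close> and \<open>r\<close>: if it saw both \<open>p\<close> and \<open>q\<close>, these would have the three common neighbors
  \<open>v\<close>, \<open>a\<close>, \<open>b\<close>.  Hence \<open>d\<close> sees \<open>q\<close> and \<open>s\<close>, and the degrees force the remaining edges \<open>p s\<close> and \<open>q r\<close>.
  The rows of the board are \<open>v p s\<close>, \<open>q a d\<close> and \<open>r b c\<close>.\<close>

lemma rook_like_coordinates:
  assumes nine: "card V = 9" and rook: rook_like
    and K: "refuge v K"
    and KE: "K = V - closed_nbrs v" and two: "\<And>x. x \<in> K \<Longrightarrow> card (nbrs x \<inter> K) = 2"
  shows "\<exists>f. bij_betw f V ({..<3::nat} \<times> {..<3::nat}) \<and>
    (\<forall>x\<in>V. \<forall>y\<in>V. x \<sim> y \<longleftrightarrow> rook_move (f x) (f y))"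
proof -
  have vV: "v \<in> V" using K by (simp add: refuge_def)
  have deg: "card (nbrs x) = 4" if "x \<in> V" for x
    using rook that unfolding rook_like_def by blast
  have pair: "rook_pair x y" if "x \<in> V" "y \<in> V" "x \<noteq> y" "\<not> x \<sim> y" for x y
  proof -
    have "y \<in> V - closed_nbrs x" using that by auto
    then show ?thesis using rook that(1) unfolding rook_like_def by blast
  qed
  have common: "card (nbrs x \<inter> nbrs y) = 2"
    if "x \<in> V" "y \<in> V" "x \<noteq> y" "\<not> x \<sim> y" for x y
    using pair[OF that] by (simp add: rook_pair_def)
  have indep: "\<not> z \<sim> w"
    if "x \<in> V" "y \<in> V" "x \<noteq> y" "\<not> x \<sim> y" "x \<sim> z" "y \<sim> z" "x \<sim> w" "y \<sim> w" for x y z w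
  proof -
    have "z \<in> nbrs x \<inter> nbrs y" "w \<in> nbrs x \<inter> nbrs y" using that(5-) by simp_all
    then show ?thesis using pair[OF that(1-4)] unfolding rook_pair_def by blast
  qed
  have apart: "\<not> z \<sim> w"
    if "x \<in> V" "y \<in> V" "z \<in> V" "x \<noteq> y" "\<not> x \<sim> y" "x \<noteq> z" "\<not> x \<sim> z" "y \<noteq> z" "\<not> y \<sim> z"
      "x \<sim> w" "y \<sim> w" for x y z w
  proof -
    have "w \<in> nbrs x \<inter> nbrs y" "z \<in> V - closed_nbrs x - closed_nbrs y"
      using that by simp_all
    then have "\<not> w \<sim> z" using pair[OF that(1,2,4,5)] unfolding rook_pair_def by blast
    then show ?thesis by (simp add: adj_commute)
  qed
  have "closed_nbrs v \<subseteq> V" using vV nbrs_subset_V by (simp add: closed_nbrs_def)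
  then have cK: "card K = 4"
    using card_Diff_subset[of "closed_nbrs v" V] card_closed_nbrs[of v] nine deg[OF vV] KE by simp
  have KV: "x \<in> V \<and> x \<noteq> v \<and> \<not> v \<sim> x \<and> \<not> x \<sim> v" if "x \<in> K" for x
    using that KE by (auto simp: adj_commute)
  obtain a where a: "a \<in> K" using cK by fastforce
  have "nbrs a \<inter> K \<noteq> {}" using two[OF a] by auto
  then obtain b where b: "b \<in> K" "a \<sim> b" by auto
  obtain d where d: "d \<in> K" "a \<sim> d" "d \<noteq> b" and Na: "\<And>w. w \<in> K \<Longrightarrow> a \<sim> w \<Longrightarrow> w = b \<or> w = d"
    using other_neighbor[OF two[OF a] b(2,1)] by metis
  have "card {a, b, d} < card K" using cK by (simp add: card_insert_if)
  moreover have "{a, b, d} \<subseteq> K" using a b d by blast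
  ultimately have "K - {a, b, d} \<noteq> {}" by (metis Diff_eq_empty_iff card_mono finite.intros leD)
  then obtain c where c: "c \<in> K" "c \<noteq> a" "c \<noteq> b" "c \<noteq> d" by blast
  have ac: "\<not> a \<sim> c" using Na[OF c(1)] c by blast
  have K4: "{a, b, c, d} = K"
    using a b c d cK adj_neq refuge_finite[OF K] by (intro card_subset_eq) (auto simp: card_insert_if)
  have Nc: "nbrs c \<inter> K \<subseteq> {b, d}"
  proof
    fix x assume "x \<in> nbrs c \<inter> K"
    then have "x \<in> K" "c \<sim> x" by simp_all
    moreover have "x \<noteq> c" "x \<noteq> a" using \<open>c \<sim> x\<close> ac adj_neq adj_sym by blast+
    ultimately show "x \<in> {b, d}" using K4 by blast
  qed
  have "nbrs c \<inter> K = {b, d}"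
    using Nc two[OF c(1)] d(3) by (intro card_seteq) auto
  then have "b \<in> nbrs c" "d \<in> nbrs c" by blast+
  then have cb: "c \<sim> b" "c \<sim> d" by simp_all
  have "nbrs b \<inter> K = {a, c}"
  proof -
    have "a \<in> nbrs b \<inter> K" "c \<in> nbrs b \<inter> K" using a b c cb(1) by (simp_all add: adj_commute)
    then show ?thesis using two_element_set[OF two[OF b(1)], of a] c(2) by blast
  qed
  moreover have "d \<noteq> a" using d(2) adj_neq by blast
  ultimately have "d \<notin> nbrs b" using d(1) c(4) by blast
  then have bd: "\<not> b \<sim> d" by simp
  note adjK = b(2) d(2) cb
  note V_K = KV[OF a] KV[OF b(1)] KV[OF c(1)] KV[OF d(1)]
  let ?P = "nbrs v \<inter> nbrs a" and ?R = "nbrs v \<inter> nbrs c"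
  let ?B = "nbrs v \<inter> nbrs b" and ?D = "nbrs v \<inter> nbrs d"
  have card2: "card ?P = 2" "card ?R = 2" "card ?B = 2" "card ?D = 2"
    using V_K by (auto intro!: common[OF vV])
  have PR: "?P \<inter> ?R = {}" and BD: "?B \<inter> ?D = {}"
    using apart[of v a c] apart[of v b d] vV V_K ac bd c d by (auto simp: adj_commute)
  have "?P \<union> ?R = nbrs v"
    using card_Un_disjoint[OF _ _ PR] card2 deg[OF vV] by (intro card_subset_eq) auto
  then have PRv: "x \<in> ?P \<or> x \<in> ?R" if "x \<in> nbrs v" for x using that by blast
  \<comment> \<open>Otherwise \<open>x\<close> and \<open>x'\<close> would have the three common neighbors \<open>v\<close>, \<open>b\<close>, \<open>y\<close>.\<close>
  have not_both: "\<not> (x \<in> nbrs y \<and> x' \<in> nbrs y)"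
    if x: "x \<in> ?B" "x' \<in> ?B" "x \<noteq> x'" and y: "y \<in> K" "y \<noteq> b" for x x' y
  proof
    assume y': "x \<in> nbrs y \<and> x' \<in> nbrs y"
    have "\<not> x \<sim> x'" using indep[OF vV, of b x x'] V_K x by auto
    then have "card (nbrs x \<inter> nbrs x') = 2"
      using common[of x x'] x nbrs_subset_V by blast
    moreover have "{v, b, y} \<subseteq> nbrs x \<inter> nbrs x'"
      using x y' by (auto simp: adj_commute)
    then have "card {v, b, y} \<le> card (nbrs x \<inter> nbrs x')" by (intro card_mono) auto
    moreover have "card {v, b, y} = 3" using y V_K KV[OF y(1)] by (auto simp: card_insert_if)
    ultimately show False by simp
  qed
  obtain p0 r0 where pr0: "?B = {p0, r0}" "p0 \<noteq> r0" using card2(3) by (auto simp: card_2_iff)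
  then have in_B: "p0 \<in> ?B" "r0 \<in> ?B" by blast+
  obtain p r where pr: "?B = {p, r}" "p \<noteq> r" "p \<in> ?P" "r \<in> ?R"
  proof -
    have "\<not> (p0 \<in> nbrs a \<and> r0 \<in> nbrs a)" "\<not> (p0 \<in> nbrs c \<and> r0 \<in> nbrs c)"
      using not_both[OF in_B pr0(2)] a b c adj_neq by blast+
    then have "p0 \<in> ?P \<and> r0 \<in> ?R \<or> r0 \<in> ?P \<and> p0 \<in> ?R" using PRv in_B by blast
    then show thesis using that[of p0 r0] that[of r0 p0] pr0 by (metis insert_commute)
  qed
  obtain q where q: "?P = {p, q}" "p \<noteq> q" by (rule two_element_set[OF card2(1) pr(3)])
  obtain s where s: "?R = {r, s}" "r \<noteq> s" by (rule two_element_set[OF card2(2) pr(4)])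
  have Nv: "nbrs v = {p, q, r, s}" using \<open>?P \<union> ?R = nbrs v\<close> q s by blast
  have mem: "y \<sim> x \<longleftrightarrow> x = x1 \<or> x = x2" if "nbrs v \<inter> nbrs y = {x1, x2}" "v \<sim> x" for x y x1 x2
  proof -
    have "x \<in> nbrs v \<inter> nbrs y \<longleftrightarrow> x \<in> {x1, x2}" using that(1) by (simp only:)
    then show ?thesis using that(2) by simp
  qed
  have pqrs: "v \<sim> p" "v \<sim> q" "v \<sim> r" "v \<sim> s" using Nv in_nbrs by blast+
  note in_P = mem[OF q(1)] and in_R = mem[OF s(1)] and in_B = mem[OF pr(1)]
  have "p \<notin> ?R" "q \<notin> ?R" using PR q by blast+
  then have neq: "p \<noteq> r" "p \<noteq> s" "q \<noteq> r" "q \<noteq> s" "p \<noteq> q" "r \<noteq> s"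
    using s q by blast+
  have "?D \<subseteq> {q, s}" using BD pr(1) Nv by blast
  then have "?D = {q, s}" using card2(4) neq by (intro card_seteq) auto
  note inner = in_P in_R in_B mem[OF this]
  have VE: "V = set [v, p, s, q, a, d, r, b, c]"
  proof -
    have "V = closed_nbrs v \<union> K" using \<open>closed_nbrs v \<subseteq> V\<close> KE by blast
    then show ?thesis using Nv K4 by (auto simp: closed_nbrs_def)
  qed
  then have dist: "distinct [v, p, s, q, a, d, r, b, c]"
    using nine by (intro card_distinct) simp
  then have dist_rev: "distinct [c, b, r, d, a, q, s, p, v]" by auto
  have outer: "a \<sim> p" "a \<sim> q" "b \<sim> p" "b \<sim> r" "c \<sim> r" "c \<sim> s" "d \<sim> q" "d \<sim> s"
    "\<not> c \<sim> p" "\<not> d \<sim> p" "\<not> c \<sim> q" "\<not> b \<sim> q" "\<not> a \<sim> r" "\<not> d \<sim> r" "\<not> a \<sim> s" "\<not> b \<sim> s"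
    using inner pqrs dist by auto
  have four: "nbrs x = {x1, x2, x3, x4}"
    if "x \<in> V" "x \<sim> x1 \<and> x \<sim> x2 \<and> x \<sim> x3 \<and> x \<sim> x4" "distinct [x1, x2, x3, x4]" for x x1 x2 x3 x4
    using card_subset_eq[of "nbrs x" "{x1, x2, x3, x4}"] deg[OF that(1)] that(2,3) by simp
  have four': "nbrs x = {x1, x2, x3, x4}"
    if "x \<in> V" "nbrs x \<subseteq> {x1, x2, x3, x4}" "distinct [x1, x2, x3, x4]" for x x1 x2 x3 x4
    using card_subset_eq[of "{x1, x2, x3, x4}" "nbrs x"] deg[OF that(1)] that(2,3) by simp
  have NK: "nbrs a = {b, d, p, q}" "nbrs b = {a, c, p, r}" "nbrs c = {b, d, r, s}" "nbrs d = {a, c, q, s}"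
    by (rule four, use VE in simp, use outer adjK adjK[THEN adj_sym] in simp, use dist in fastforce)+
  have "\<not> p \<sim> q" "\<not> p \<sim> r" "\<not> q \<sim> s" "\<not> r \<sim> s"
    using indep[OF vV, of a p q] indep[OF vV, of b p r] indep[OF vV, of d q s] indep[OF vV, of c r s]
      V_K pqrs outer by blast+
  moreover have "x \<in> {v, p, s, q, a, d, r, b, c}" if "y \<sim> x" for x y
    using adj_in_V[OF that] VE by simp
  ultimately have NP: "nbrs p \<subseteq> {v, a, b, s}" "nbrs q \<subseteq> {v, a, d, r}" "nbrs r \<subseteq> {v, b, c, q}" "nbrs s \<subseteq> {v, c, d, p}"
    using adj_irrefl outer adj_commute unfolding nbrs_def by blast+
  have "nbrs p = {v, a, b, s}" "nbrs q = {v, a, d, r}" "nbrs r = {v, b, c, q}" "nbrs s = {v, c, d, p}"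
    by (rule four', use VE in simp, use NP in simp, use dist in fastforce)+
  note N = Nv NK this
  have adjE: "v \<sim> x \<longleftrightarrow> x \<in> {p, q, r, s}" "a \<sim> x \<longleftrightarrow> x \<in> {b, d, p, q}" "b \<sim> x \<longleftrightarrow> x \<in> {a, c, p, r}"
    "c \<sim> x \<longleftrightarrow> x \<in> {b, d, r, s}" "d \<sim> x \<longleftrightarrow> x \<in> {a, c, q, s}" "p \<sim> x \<longleftrightarrow> x \<in> {v, a, b, s}"
    "q \<sim> x \<longleftrightarrow> x \<in> {v, a, d, r}" "r \<sim> x \<longleftrightarrow> x \<in> {v, b, c, q}" "s \<sim> x \<longleftrightarrow> x \<in> {v, c, d, p}" for x
    unfolding N[symmetric] by simp_all
  define f :: "'a \<Rightarrow> nat \<times> nat" where "f x = (if x = v then (0, 0) else if x = p then (0, 1) else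
    if x = s then (0, 2) else if x = q then (1, 0) else if x = a then (1, 1) else if x = d then (1, 2) else
    if x = r then (2, 0) else if x = b then (2, 1) else (2, 2))" for x
  have fE: "f v = (0, 0)" "f p = (0, 1)" "f s = (0, 2)" "f q = (1, 0)" "f a = (1, 1)" "f d = (1, 2)"
    "f r = (2, 0)" "f b = (2, 1)" "f c = (2, 2)"
    using dist dist_rev by (simp_all add: f_def)
  have img: "f ` V = {..<3} \<times> {..<3}"
  proof -
    have "{..<3::nat} = {0, 1, 2}" by auto
    then show ?thesis unfolding VE by (auto simp: fE)
  qed
  then have "inj_on f V" using nine finite_V by (intro eq_card_imp_inj_on) simp_all
  then have "bij_betw f V ({..<3} \<times> {..<3})" using img by (simp add: bij_betw_def)
  moreover have "\<forall>x\<in>V. \<forall>y\<in>V. x \<sim> y \<longleftrightarrow> rook_move (f x) (f y)"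
    unfolding VE using dist dist_rev by (simp add: fE adjE rook_move_def)
  ultimately show ?thesis by (intro exI[of _ f] conjI)
qed


lemma refuges_force_rook:
  assumes nine: "card V = 9" and refuges: "\<And>v. v \<in> V \<Longrightarrow> \<exists>K. refuge v K"
  shows "\<exists>f. bij_betw f V ({..<3::nat} \<times> {..<3::nat}) \<and>
    (\<forall>x\<in>V. \<forall>y\<in>V. x \<sim> y \<longleftrightarrow> rook_move (f x) (f y))"
proof -
  have "V \<noteq> {}" using nine by auto
  then have "Max ((\<lambda>x. card (nbrs x)) ` V) \<in> (\<lambda>x. card (nbrs x)) ` V"
    using finite_V by (intro Max_in) auto
  then obtain v where v: "v \<in> V" "card (nbrs v) = Max ((\<lambda>x. card (nbrs x)) ` V)" by auto
  have max: "card (nbrs x) \<le> card (nbrs v)" if "x \<in> V" for x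
    using that finite_V unfolding v(2) by (intro Max_ge) auto
  obtain K where K: "refuge v K" using refuges[OF v(1)] by blast
  have "card (nbrs v) = 3 \<or> card (nbrs v) = 4"
    using max_degree_refuge_cases[OF nine K max] by blast
  moreover have "card (nbrs v) \<noteq> 3"
    using degree_three_impossible[OF nine _ refuges v(1)] max by fastforce
  ultimately have four: "card (nbrs v) = 4" by blast
  then have rook_like
    using degree_four_rook_like[OF nine _ refuges v(1)] max by fastforce
  then show ?thesis
    using max_degree_refuge_eq[OF nine K max] max_degree_refuge_two_regular[OF nine K max]
    by (rule rook_like_coordinates[OF nine _ K])
qed

end

lemma (in connected_pair_graph) two_cops_win_or_rook:
  assumes nine: "card (pverts G) = 9" and no_win: "\<not> lazy_cops_win G 2"
  shows "\<exists>f. bij_betw f (pverts G) ({..<3::nat} \<times> {..<3::nat}) \<and>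
    (\<forall>x\<in>pverts G. \<forall>y\<in>pverts G. (x, y) \<in> parcs G \<longleftrightarrow> rook_move (f x) (f y))"
proof (rule refuges_force_rook[OF nine])
  fix v assume v: "v \<in> pverts G"
  then obtain r where "r \<in> pverts G" "\<not> wins v v r" using lazy_cops_win_2[OF v v] no_win by blast
  then show "\<exists>K. refuge v K" using refuge_exists[OF v v] by blast
qed

section \<open>The rook's graph\<close>

abbreviation (input) rooks_graph :: "(nat \<times> nat) pair_pre_digraph" where
  "rooks_graph \<equiv> complete_graph 3 \<box> complete_graph 3"

lemma pverts_rooks_graph: "pverts rooks_graph = {..<3} \<times> {..<3}"
  by (simp add: cartesian_product_def complete_graph_def)

lemma parcs_rooks_graph:
  "(p, q) \<in> parcs rooks_graph \<longleftrightarrow> p \<in> {..<3} \<times> {..<3} \<and> q \<in> {..<3} \<times> {..<3} \<and>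
     rook_move p q"
  by (cases p; cases q) (auto simp: cartesian_product_def complete_graph_def rook_move_def)

lemma pair_graph_rooks_graph: "pair_graph rooks_graph"
proof
  show "finite (pverts rooks_graph)" by (simp add: pverts_rooks_graph)
  have "parcs rooks_graph \<subseteq> pverts rooks_graph \<times> pverts rooks_graph"
    by (auto simp: parcs_rooks_graph rook_move_def pverts_rooks_graph)
  then show "finite (parcs rooks_graph)"
    by (rule finite_subset) (simp add: pverts_rooks_graph)
  show "fst e \<in> pverts rooks_graph" "snd e \<in> pverts rooks_graph" "fst e \<noteq> snd e"
    if "e \<in> parcs rooks_graph" for e
    using that by (cases e; simp add: parcs_rooks_graph rook_move_def pverts_rooks_graph; auto)+
  show "symmetric (with_proj rooks_graph)"
    by (auto simp: symmetric_def sym_def with_proj_def arcs_ends_def arc_to_ends_def parcs_rooks_graph rook_move_def image_iff)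
qed

lemma connected_rooks_graph: "connected_graph rooks_graph"
proof -
  interpret R: pair_graph rooks_graph by (rule pair_graph_rooks_graph)
  have "p \<rightarrow>\<^sup>*\<^bsub>with_proj rooks_graph\<^esub> q" if pq: "p \<in> pverts rooks_graph" "q \<in> pverts rooks_graph" for p q
  proof -
    have step: "x \<rightarrow>\<^sup>*\<^bsub>with_proj rooks_graph\<^esub> y"
      if "x = y \<or> (x, y) \<in> parcs rooks_graph" "x \<in> pverts rooks_graph" for x y
      using that by (auto intro: R.adj_reachable_trans)
    define m where "m = (fst p, snd q)"
    have "p = m \<or> (p, m) \<in> parcs rooks_graph" "m = q \<or> (m, q) \<in> parcs rooks_graph"
      "m \<in> pverts rooks_graph"
      using pq by (auto simp: m_def parcs_rooks_graph rook_move_def pverts_rooks_graph prod_eq_iff)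
    then show ?thesis using step pq R.reachable_trans by blast
  qed
  moreover have "(0, 0) \<in> pverts rooks_graph" by (simp add: pverts_rooks_graph)
  ultimately have "connected (with_proj rooks_graph)"
    by (auto simp: connected_def strongly_connected_def intro: R.reachable_mk_symmetricI)
  then show ?thesis
    using pair_graph_rooks_graph by (simp add: connected_graph_def)
qed

text \<open>The diagonal cop in the robber's row captures him in the first round.\<close>

lemma three_lazy_cops_win_rooks_graph: "lazy_cops_win rooks_graph 3"
proof -
  define diag :: "(nat \<times> nat) list" where "diag = [(0, 0), (1, 1), (2, 2)]"
  define \<sigma> where "\<sigma> h = (if h = [] then diag else diag[fst (hd h) := hd h])" for h
  have hd_r: "hd (map r [0..<Suc n]) = r 0" for r :: "nat \<Rightarrow> nat \<times> nat" and n
    by (simp add: upt_conv_Cons del: upt_Suc)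
  have start: "fst (r 0) < 3 \<and> snd (r 0) < 3" if "robber_walk rooks_graph r" for r
    using that by (cases "r 0") (simp add: robber_walk_def pverts_rooks_graph)
  have nth: "diag ! i = (i, i)" if "i < 3" for i
    using that by (auto simp: diag_def less_Suc_eq numeral_3_eq_3)
  have len: "length diag = 3" by (simp add: diag_def)
  have \<sigma>: "\<sigma> (map r [0..<Suc n]) = diag[fst (r 0) := r 0]" for r n
    unfolding \<sigma>_def hd_r by simp
  have "lazy_cop_move rooks_graph (\<sigma> (map r [0..<n])) (\<sigma> (map r [0..<Suc n]))"
    if walk: "robber_walk rooks_graph r" for r n
  proof (cases n)
    case 0
    let ?i = "fst (r 0)"
    have "r 0 = (?i, ?i) \<or> ((?i, ?i), r 0) \<in> parcs rooks_graph"
      using start[OF walk] by (cases "r 0") (auto simp: parcs_rooks_graph rook_move_def)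
    moreover have "diag[?i := (?i, ?i)] = diag"
      using nth start[OF walk] by (metis list_update_id)
    ultimately have "lazy_cop_move rooks_graph diag (diag[?i := r 0])"
      unfolding lazy_cop_move_def using start[OF walk] nth len by metis
    then show ?thesis unfolding \<sigma> 0 by (simp add: \<sigma>_def)
  next
    case (Suc m)
    then show ?thesis unfolding Suc \<sigma> by (simp add: lazy_cop_move_def)
  qed
  then have "lazy_cop_strategy rooks_graph 3 \<sigma>"
    unfolding lazy_cop_strategy_def by (auto simp: \<sigma>_def diag_def pverts_rooks_graph)
  moreover have "captures \<sigma> r" if walk: "robber_walk rooks_graph r" for r
  proof -
    have "r 0 \<in> set (\<sigma> (map r [0..<Suc 0]))"
      unfolding \<sigma> using start[OF walk] len by (intro set_update_memI) simp
    then show ?thesis unfolding captures_def by blast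
  qed
  ultimately show ?thesis unfolding lazy_cops_win_def by blast
qed

definition unseen :: "(nat \<times> nat) list \<Rightarrow> nat \<times> nat \<Rightarrow> bool" where
  "unseen ps p \<longleftrightarrow> p \<in> pverts rooks_graph \<and> fst p \<notin> fst ` set ps \<and> snd p \<notin> snd ` set ps"

lemma free_line:
  fixes f :: "'b \<Rightarrow> nat"
  assumes "length ps \<le> 2"
  shows "\<exists>i<3. i \<notin> f ` set ps"
proof -
  have "card (f ` set ps) < card {..<3::nat}"
    using le_trans[OF card_image_le card_length, of ps f] assms by simp
  then have "\<not> {..<3} \<subseteq> f ` set ps" by (meson card_mono finite_imageI finite_set leD)
  then show ?thesis by auto
qed

lemma unseen_exists: "length ps \<le> 2 \<Longrightarrow> \<exists>p. unseen ps p"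
  using free_line[of ps fst] free_line[of ps snd] unfolding unseen_def pverts_rooks_graph
  by (metis fst_conv lessThan_iff mem_Sigma_iff snd_conv)

text \<open>A cop move changes only one coordinate, so the robber's row or his column stays free of cops;
  he slides along it to the crossing with a free column or row.\<close>

lemma unseen_escape:
  assumes few: "length ps \<le> 2" and move: "lazy_cop_move rooks_graph ps qs" and safe: "unseen ps p"
  shows "p \<notin> set qs \<and> (\<exists>p'. (p' = p \<or> (p, p') \<in> parcs rooks_graph) \<and> unseen qs p')"
proof -
  have len: "length qs \<le> 2" using few move by (auto simp: lazy_cop_move_def)
  have p: "fst p < 3" "snd p < 3" using safe by (auto simp: unseen_def pverts_rooks_graph mem_Times_iff)
  have "map fst qs = map fst ps \<or> map snd qs = map snd ps"
  proof (cases "qs = ps")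
    case False
    then obtain i w where i: "i < length ps" and w: "(ps ! i, w) \<in> parcs rooks_graph"
      and qs: "qs = ps[i := w]"
      using move unfolding lazy_cop_move_def by blast
    have "fst w = map fst ps ! i \<or> snd w = map snd ps ! i"
      using i w by (auto simp: parcs_rooks_graph rook_move_def)
    then show ?thesis unfolding qs map_update using list_update_id by metis
  qed simp
  then have "fst ` set qs = fst ` set ps \<or> snd ` set qs = snd ` set ps"
    by (metis list.set_map)
  then show ?thesis
  proof
    assume row: "fst ` set qs = fst ` set ps"
    obtain j where j: "j < 3" "j \<notin> snd ` set qs" using free_line[OF len] by blast
    have "unseen qs (fst p, j)" "fst p \<notin> fst ` set qs"
      using safe j p unfolding unseen_def row by (auto simp: pverts_rooks_graph)
    moreover have "(fst p, j) = p \<or> (p, (fst p, j)) \<in> parcs rooks_graph"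
      using p j by (auto simp: parcs_rooks_graph rook_move_def mem_Times_iff prod_eq_iff)
    ultimately show ?thesis by blast
  next
    assume col: "snd ` set qs = snd ` set ps"
    obtain i where i: "i < 3" "i \<notin> fst ` set qs" using free_line[OF len] by blast
    have "unseen qs (i, snd p)" "snd p \<notin> snd ` set qs"
      using safe i p unfolding unseen_def col by (auto simp: pverts_rooks_graph)
    moreover have "(i, snd p) = p \<or> (p, (i, snd p)) \<in> parcs rooks_graph"
      using p i by (auto simp: parcs_rooks_graph rook_move_def mem_Times_iff prod_eq_iff)
    ultimately show ?thesis by blast
  qed
qed

text \<open>The legality of the moves of \<open>\<sigma>\<close> is granted only along infinite robber walks.  Therefore the fleeing robber is defined on all histories, staying put where no escape exists:
  he is a walk before anything is known about the cops.\<close>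

lemma two_lazy_cops_lose_rooks_graph:
  assumes few: "k \<le> 2"
  shows "\<not> lazy_cops_win rooks_graph k"
proof
  assume "lazy_cops_win rooks_graph k"
  then obtain \<sigma> where strat: "lazy_cop_strategy rooks_graph k \<sigma>"
    and win: "\<And>r. robber_walk rooks_graph r \<Longrightarrow> captures \<sigma> r"
    unfolding lazy_cops_win_def by blast
  have start: "length (\<sigma> []) = k" using strat by (simp add: lazy_cop_strategy_def)
  then obtain p0 where p0: "unseen (\<sigma> []) p0" using unseen_exists few by blast
  define flee where "flee ps p =
    (if \<exists>p'. (p' = p \<or> (p, p') \<in> parcs rooks_graph) \<and> unseen ps p'
     then SOME p'. (p' = p \<or> (p, p') \<in> parcs rooks_graph) \<and> unseen ps p' else p)" for ps p
  have flee: "(flee ps p = p \<or> (p, flee ps p) \<in> parcs rooks_graph) \<and> unseen ps (flee ps p)"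
    if "\<exists>p'. (p' = p \<or> (p, p') \<in> parcs rooks_graph) \<and> unseen ps p'" for ps p
    unfolding flee_def if_P[OF that] by (rule someI_ex[OF that])
  then have flee_step: "flee ps p = p \<or> (p, flee ps p) \<in> parcs rooks_graph" for ps p
    by (cases "\<exists>p'. (p' = p \<or> (p, p') \<in> parcs rooks_graph) \<and> unseen ps p'") (auto simp: flee_def)
  \<comment> \<open>The robber moves depend on the strategy and on his own history, so the recursion is on histories.\<close>
  define hist where "hist = rec_nat [p0] (\<lambda>_ h. h @ [flee (\<sigma> h) (last h)])"
  define r where "r n = last (hist n)" for n
  have hist: "hist n = map r [0..<Suc n]" for n
    by (induction n) (simp_all add: hist_def r_def)
  have r_Suc: "r (Suc n) = flee (\<sigma> (map r [0..<Suc n])) (r n)" for n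
    unfolding hist[symmetric] by (simp add: r_def hist_def)
  have "r 0 = p0" by (simp add: r_def hist_def)
  then have walk: "robber_walk rooks_graph r"
    unfolding robber_walk_def r_Suc using p0 flee_step by (auto simp: unseen_def)
  have move: "lazy_cop_move rooks_graph (\<sigma> (map r [0..<n])) (\<sigma> (map r [0..<Suc n]))" for n
    using strat walk unfolding lazy_cop_strategy_def by blast
  have len: "length (\<sigma> (map r [0..<n])) = k" for n
  proof (induction n)
    case 0
    then show ?case using start by simp
  next
    case (Suc n)
    then show ?case using move[of n] by (auto simp: lazy_cop_move_def simp del: upt_Suc)
  qed
  have safe: "unseen (\<sigma> (map r [0..<n])) (r n)" for n
  proof (induction n)
    case 0
    then show ?case using p0 \<open>r 0 = p0\<close> by simp
  next
    case (Suc n)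
    then show ?case
      using unseen_escape[OF _ move Suc] len few flee unfolding r_Suc by simp
  qed
  have "r n \<notin> set (\<sigma> (map r [0..<n]))" for n
    using safe[of n] by (auto simp: unseen_def)
  moreover have "r n \<notin> set (\<sigma> (map r [0..<Suc n]))" for n
    using unseen_escape[OF _ move safe] len few by simp
  ultimately have "\<not> captures \<sigma> r" unfolding captures_def by blast
  then show False using win[OF walk] by blast
qed

lemma lazy_cop_number_rooks_graph: "lazy_cop_number rooks_graph = 3"
  unfolding lazy_cop_number_def
proof (rule Least_equality)
  show "lazy_cops_win rooks_graph 3" by (rule three_lazy_cops_win_rooks_graph)
  show "3 \<le> k" if "lazy_cops_win rooks_graph k" for k
    using that two_lazy_cops_lose_rooks_graph[of k] by linarith
qed

theorem theorem2p4:
  shows "(connected_graph (complete_graph 3 \<box> complete_graph 3) \<and>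
          card (pverts (complete_graph 3 \<box> complete_graph 3)) = 9 \<and>
          lazy_cop_number (complete_graph 3 \<box> complete_graph 3) = 3) \<and>
         (\<forall>H :: 'a pair_pre_digraph.
            connected_graph H \<and> card (pverts H) = 9 \<and>
            \<not> graph_isomorphic H (complete_graph 3 \<box> complete_graph 3) \<longrightarrow>
            lazy_cop_number H \<le> 2)"
proof (intro conjI allI impI)
  show "connected_graph rooks_graph" by (rule connected_rooks_graph)
  show "card (pverts rooks_graph) = 9" by (simp add: pverts_rooks_graph)
  show "lazy_cop_number rooks_graph = 3" by (rule lazy_cop_number_rooks_graph)
next
  fix H :: "'a pair_pre_digraph"
  assume H: "connected_graph H \<and> card (pverts H) = 9 \<and> \<not> graph_isomorphic H rooks_graph"
  then interpret connected_pair_graph H by unfold_locales simp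
  have "lazy_cops_win H 2"
  proof (rule ccontr)
    assume "\<not> lazy_cops_win H 2"
    moreover have "card (pverts H) = 9" using H by blast
    ultimately obtain f where bij: "bij_betw f (pverts H) ({..<3::nat} \<times> {..<3::nat})"
      and adj: "\<forall>x\<in>pverts H. \<forall>y\<in>pverts H. (x, y) \<in> parcs H \<longleftrightarrow> rook_move (f x) (f y)"
      using two_cops_win_or_rook by meson
    have "(x, y) \<in> parcs H \<longleftrightarrow> (f x, f y) \<in> parcs rooks_graph" if "x \<in> pverts H" "y \<in> pverts H" for x y
      using adj bij_betwE[OF bij] that by (simp add: parcs_rooks_graph)
    then have "graph_isomorphic H rooks_graph"
      using graph_isomorphic_iff[OF pair_graph pair_graph_rooks_graph] bij pverts_rooks_graph by metis
    then show False using H by blast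
  qed
  then show "lazy_cop_number H \<le> 2" unfolding lazy_cop_number_def by (rule Least_le)
qed

end
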